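(* Let $\nu$ be a non-atomic self-similar Borel probability measure on $\mathbb{R}$. If $$\lim_{|q|\to\infty}\mathcal{F}_q(\nu)=0,$$ then $\nu$ is pointwise absolutely normal.
   Context: For a Borel probability measure $\mu$ on $\mathbb{R}$, $\mathcal{F}_q(\mu):=\int e^{2\pi i x q}\,d\mu(x)$ for $q\in\mathbb{R}$; the limit in the claim is over real $q$. A self-similar IFS is a finite collection $\Phi=\{f_1,\dots,f_\ell\}$ of maps $f_i:\mathbb{R}\to\mathbb{R}$, $f_i(x)=s_i x+t_i$, with $s_i\in(-1,1)\setminus\{0\}$ and $t_i\in\mathbb{R}$, leaving some compact interval $J\subseteq\mathbb{R}$ invariant ($f_i(J)\subseteq J$ for all $i$). It is always assumed that the fixed points of $f_i$ and $f_j$ differ for some $i,j$. Given a probability vector $\mathbf{p}=(p_1,\dots,p_\ell)$ with $p_i>0$ for all $i$ and $\sum_i p_i=1$, there is a unique Borel probability measure $\nu$ on $\mathbb{R}$ with $\nu=\sum_{i=1}^{\ell} p_i\, f_i\nu$, where $f_i\nu$ is the push-forward of $\nu$ by $f_i$. Measures $\nu$ arising in this way are called self-similar measures. For an integer $b\ge 2$ let $T_b(x)=b\cdot x \bmod 1$, $x\in\mathbb{R}$, with values in $[0,1)$. A number $x\in\mathbb{R}$ is $b$-normal (normal to base $b$) if $\frac1N\sum_{n=1}^N\delta_{T_b^n(x)}$ converges in the weak$^*$ sense, as $N\to\infty$, to the Lebesgue measure $\lambda$ on $[0,1]$. It is absolutely normal if it is $b$-normal for every integer $b\ge2$. A measure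 $\mu$ on $\mathbb{R}$ is pointwise absolutely normal if $\mu$-almost every $x$ is absolutely normal. *)

theory Defs
  imports "HOL-Probability.Probability"
begin

definition fourier_transform :: "real measure \<Rightarrow> real \<Rightarrow> complex" where
  "fourier_transform \<mu> q = (CLINT x|\<mu>. exp (2 * pi * \<i> * x * q))"

text \<open>The Borel measure \<open>\<Sum>i\<in>I. c i * M i\<close> on the real line, for a finite index set \<open>I\<close> and
  nonnegative weights \<open>c\<close>; \<open>emeasure_lin_comb\<close> shows that it has the expected values.\<close>

definition lin_comb :: "'i set \<Rightarrow> ('i \<Rightarrow> real) \<Rightarrow> ('i \<Rightarrow> real measure) \<Rightarrow> real measure" where
  "lin_comb I c M =
     measure_of UNIV (sets borel) (\<lambda>A. \<Sum>i\<in>I. ennreal (c i) * emeasure (M i) A)"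

lemma sets_lin_comb [simp]: "sets (lin_comb I c M) = sets borel"
  and space_lin_comb [simp]: "space (lin_comb I c M) = UNIV"
  using sets.sigma_sets_eq[of "borel :: real measure"] by (simp_all add: lin_comb_def)

lemma emeasure_lin_comb:
  assumes "\<And>i. i \<in> I \<Longrightarrow> sets (M i) = sets borel" and "A \<in> sets borel"
  shows "emeasure (lin_comb I c M) A = (\<Sum>i\<in>I. ennreal (c i) * emeasure (M i) A)"
proof (rule emeasure_measure_of[OF lin_comb_def])
  show "countably_additive (sets (lin_comb I c M)) (\<lambda>A. \<Sum>i\<in>I. ennreal (c i) * emeasure (M i) A)"
  proof (rule countably_additiveI)
    fix B :: "nat \<Rightarrow> real set"
    assume B: "range B \<subseteq> sets (lin_comb I c M)" "disjoint_family B"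
    have "(\<Sum>n. \<Sum>i\<in>I. ennreal (c i) * emeasure (M i) (B n))
        = (\<Sum>i\<in>I. \<Sum>n. ennreal (c i) * emeasure (M i) (B n))"
      by (rule suminf_sum) simp
    also have "\<dots> = (\<Sum>i\<in>I. ennreal (c i) * emeasure (M i) (\<Union>n. B n))"
      using B assms(1) by (intro sum.cong refl) (simp add: suminf_emeasure)
    finally show "(\<Sum>n. \<Sum>i\<in>I. ennreal (c i) * emeasure (M i) (B n))
        = (\<Sum>i\<in>I. ennreal (c i) * emeasure (M i) (\<Union>n. B n))" .
  qed
qed (use assms in \<open>auto simp: positive_def\<close>)

definition ifs_map :: "(nat \<Rightarrow> real) \<Rightarrow> (nat \<Rightarrow> real) \<Rightarrow> nat \<Rightarrow> real \<Rightarrow> real" where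
  "ifs_map s t i x = s i * x + t i"

text \<open>The maps are indexed by \<open>{..<l}\<close> rather than \<open>{1..l}\<close>.\<close>

definition self_similar_ifs :: "nat \<Rightarrow> (nat \<Rightarrow> real) \<Rightarrow> (nat \<Rightarrow> real) \<Rightarrow> bool" where
  "self_similar_ifs l s t \<longleftrightarrow>
     (\<forall>i<l. s i \<in> {-1<..<1} - {0}) \<and>
     (\<exists>a b. a \<le> b \<and> (\<forall>i<l. ifs_map s t i ` {a..b} \<subseteq> {a..b})) \<and>
     (\<exists>i<l. \<exists>j<l. \<exists>x y. ifs_map s t i x = x \<and> ifs_map s t j y = y \<and> x \<noteq> y)"

definition positive_prob_vector :: "nat \<Rightarrow> (nat \<Rightarrow> real) \<Rightarrow> bool" where
  "positive_prob_vector l p \<longleftrightarrow> (\<forall>i<l. p i > 0) \<and> (\<Sum>i<l. p i) = 1"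

definition self_similar_measure :: "real measure \<Rightarrow> bool" where
  "self_similar_measure \<nu> \<longleftrightarrow> real_distribution \<nu> \<and>
     (\<exists>l s t p. self_similar_ifs l s t \<and> positive_prob_vector l p \<and>
        \<nu> = lin_comb {..<l} p (\<lambda>i. distr \<nu> borel (ifs_map s t i)))"

definition non_atomic :: "real measure \<Rightarrow> bool" where
  "non_atomic \<mu> \<longleftrightarrow> (\<forall>x. emeasure \<mu> {x} = 0)"

definition times_mod_one :: "nat \<Rightarrow> real \<Rightarrow> real" where
  "times_mod_one b x = frac (real b * x)"

definition empirical_measure :: "nat \<Rightarrow> real \<Rightarrow> nat \<Rightarrow> real measure" where
  "empirical_measure b x N =
     lin_comb {1..N} (\<lambda>_. 1 / real N) (\<lambda>n. return borel ((times_mod_one b ^^ n) x))"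

definition lebesgue_unit :: "real measure" where
  "lebesgue_unit = density lborel (indicator {0..1})"

text \<open>Finite Borel measures on the line that are carried by a compact set \<open>K\<close>, viewed as elements
  of the dual of \<open>C(K)\<close>.\<close>

definition weak_star_conv_on :: "real set \<Rightarrow> (nat \<Rightarrow> real measure) \<Rightarrow> real measure \<Rightarrow> bool" where
  "weak_star_conv_on K M_seq M \<longleftrightarrow>
     (\<forall>f :: real \<Rightarrow> real. continuous_on K f \<longrightarrow>
        (\<lambda>N. LINT x:K|M_seq N. f x) \<longlonglongrightarrow> (LINT x:K|M. f x))"

definition normal_to_base :: "nat \<Rightarrow> real \<Rightarrow> bool" where
  "normal_to_base b x \<longleftrightarrow> weak_star_conv_on {0..1} (empirical_measure b x) lebesgue_unit"

definition absolutely_normal :: "real \<Rightarrow> bool" where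
  "absolutely_normal x \<longleftrightarrow> (\<forall>b\<ge>2. normal_to_base b x)"

definition pointwise_absolutely_normal :: "real measure \<Rightarrow> bool" where
  "pointwise_absolutely_normal \<mu> \<longleftrightarrow> (AE x in \<mu>. absolutely_normal x)"

end

theory Submission
  imports Defs
begin

text \<open>By Weyl's criterion it suffices that the means of \<open>g n x = cis (a * b ^ n * x)\<close>, for \<open>a \<noteq> 0\<close>,
  tend to 0 almost everywhere.  View \<open>\<nu>\<close> as the law of a random branch of the tree of cylinders, and
  stop it for the index \<open>n\<close> at the first cylinder whose contraction ratio is at most \<open>Q / b ^ n\<close>.  The
  conditional expectation \<open>c n\<close> of \<open>g n\<close> there is, up to a phase, a value of the Fourier transform of
  \<open>\<nu>\<close> at a large frequency, hence at most \<open>\<epsilon>\<close> if \<open>Q\<close> is large.  Along the branch, the sum of the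
  \<open>g n - c n\<close> over \<open>n \<le> N\<close> unfolds into \<open>O(N)\<close> martingale increments; each of them is bounded
  independently of \<open>N\<close>, because the contributions of the indices already stopped decay geometrically.
  So its second moment is \<open>O(N)\<close>, which is summable along \<open>N = j\<^sup>2\<close> after dividing by \<open>N\<^sup>2\<close>.  No symbolic
  space is needed: the second moment is bounded by recursion over affine images of \<open>\<nu>\<close>.\<close>

section \<open>Integration against linear combinations of measures\<close>

lemma nn_integral_lin_comb:
  assumes "finite I" and M: "\<And>i. i \<in> I \<Longrightarrow> sets (M i) = sets borel"
    and "f \<in> borel_measurable borel"
  shows "(\<integral>\<^sup>+x. f x \<partial>lin_comb I c M) = (\<Sum>i\<in>I. ennreal (c i) * (\<integral>\<^sup>+x. f x \<partial>M i))"
  using assms(3)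
proof induction
  have meas: "g \<in> borel_measurable (lin_comb I c M)" "i \<in> I \<Longrightarrow> g \<in> borel_measurable (M i)"
    if "g \<in> borel_measurable borel" for g :: "real \<Rightarrow> ennreal" and i
    using that M by (simp_all cong: measurable_cong_sets)
  {
    case (cong f g)
    then have "f = g" by auto
    with cong show ?case by simp
  next
    case (set A)
    then have "A \<in> sets (M i)" if "i \<in> I" for i using M that by simp
    with set show ?case by (simp add: emeasure_lin_comb M)
  next
    case (mult u a)
    then show ?case
      by (simp add: nn_integral_cmult meas sum_distrib_left mult.left_commute)
  next
    case (add u v)
    then show ?case
      by (simp add: nn_integral_add meas sum.distrib distrib_left)
  next
    case (seq U)
    have "(\<integral>\<^sup>+x. (SUP n. U n x) \<partial>lin_comb I c M) = (SUP n. \<Sum>i\<in>I. ennreal (c i) * (\<integral>\<^sup>+x. U n x \<partial>M i))"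
      using seq by (subst nn_integral_monotone_convergence_SUP) (auto simp: meas)
    also have "\<dots> = (\<Sum>i\<in>I. SUP n. ennreal (c i) * (\<integral>\<^sup>+x. U n x \<partial>M i))"
      using seq by (intro ennreal_SUP_sum)
        (auto simp: incseq_def le_fun_def intro!: mult_left_mono nn_integral_mono)
    also have "\<dots> = (\<Sum>i\<in>I. ennreal (c i) * (\<integral>\<^sup>+x. (SUP n. U n x) \<partial>M i))"
      using seq by (intro sum.cong refl)
        (auto simp: SUP_mult_left_ennreal[symmetric] nn_integral_monotone_convergence_SUP meas)
    finally show ?case by (simp add: image_comp)
  }
qed

text \<open>The positive and negative parts of \<open>f\<close> are treated separately by the
  nonnegative case; integrability makes all the integrals finite, so \<open>enn2real\<close>
  commutes with the weighted sum.\<close>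

lemma integral_lin_comb:
  fixes f :: "real \<Rightarrow> real"
  assumes I: "finite I" and M: "\<And>i. i \<in> I \<Longrightarrow> sets (M i) = sets borel"
    and c: "\<And>i. i \<in> I \<Longrightarrow> 0 \<le> c i" and f [measurable]: "f \<in> borel_measurable borel"
    and int: "\<And>i. i \<in> I \<Longrightarrow> integrable (M i) f"
  shows "(\<integral>x. f x \<partial>lin_comb I c M) = (\<Sum>i\<in>I. c i * (\<integral>x. f x \<partial>M i))"
proof -
  have fin: "(\<integral>\<^sup>+x. ennreal (norm (f x)) \<partial>M i) < \<infinity>" if "i \<in> I" for i
    using int[OF that] by (simp add: integrable_iff_bounded)
  have part: "(\<integral>\<^sup>+x. ennreal (g x) \<partial>M i) < top"
    if "i \<in> I" "\<And>x. g x \<le> norm (f x)" for i and g :: "real \<Rightarrow> real"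
  proof (rule le_less_trans)
    show "(\<integral>\<^sup>+x. ennreal (g x) \<partial>M i) \<le> (\<integral>\<^sup>+x. ennreal (norm (f x)) \<partial>M i)"
      using that(2) by (intro nn_integral_mono ennreal_leI)
  qed (use fin[OF that(1)] in simp)
  have enn: "enn2real (\<Sum>i\<in>I. ennreal (c i) * (\<integral>\<^sup>+x. ennreal (g x) \<partial>M i))
      = (\<Sum>i\<in>I. c i * enn2real (\<integral>\<^sup>+x. ennreal (g x) \<partial>M i))"
    if "\<And>x. g x \<le> norm (f x)" for g :: "real \<Rightarrow> real"
    using part[OF _ that] c
    by (subst enn2real_sum) (auto simp: enn2real_mult ennreal_mult_less_top intro!: sum.cong)
  have "integrable (lin_comb I c M) f"
    using fin c I by (auto simp: integrable_iff_bounded nn_integral_lin_comb[OF I M]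
        ennreal_mult_less_top ennreal_sum_less_top cong: measurable_cong_sets)
  then have "(\<integral>x. f x \<partial>lin_comb I c M)
    = enn2real (\<Sum>i\<in>I. ennreal (c i) * (\<integral>\<^sup>+x. ennreal (f x) \<partial>M i))
      - enn2real (\<Sum>i\<in>I. ennreal (c i) * (\<integral>\<^sup>+x. ennreal (- f x) \<partial>M i))"
    by (simp add: real_lebesgue_integral_def nn_integral_lin_comb[OF I M])
  also have "\<dots> = (\<Sum>i\<in>I. c i * (enn2real (\<integral>\<^sup>+x. ennreal (f x) \<partial>M i)
      - enn2real (\<integral>\<^sup>+x. ennreal (- f x) \<partial>M i)))"
    by (subst (1 2) enn) (auto simp: sum_subtractf right_diff_distrib)
  also have "\<dots> = (\<Sum>i\<in>I. c i * (\<integral>x. f x \<partial>M i))"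
    using int by (simp add: real_lebesgue_integral_def)
  finally show ?thesis .
qed

section \<open>Weyl's criterion\<close>

definition fourier_char :: "int \<Rightarrow> real \<Rightarrow> complex" where
  "fourier_char k y = cis (2 * pi * k * y)"

lemma fourier_char_add: "fourier_char (j + k) y = fourier_char j y * fourier_char k y"
  by (simp add: fourier_char_def cis_mult algebra_simps)

lemma fourier_char_0 [simp]: "fourier_char 0 y = 1"
  by (simp add: fourier_char_def)

lemma continuous_on_cis' [continuous_intros]:
  "continuous_on A f \<Longrightarrow> continuous_on A (\<lambda>x. cis (f x))" for f :: "'a::topological_space \<Rightarrow> real"
  by (rule continuous_on_compose2[OF continuous_on_cis[OF continuous_on_id]]) auto

lemma continuous_on_fourier_char [continuous_intros]: "continuous_on A (fourier_char k)"
  unfolding fourier_char_def by (intro continuous_intros)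

lemma fourier_char_frac: "fourier_char k (frac y) = fourier_char k y"
proof -
  have "fourier_char k y = fourier_char k (frac y) * cis (2 * pi * (k * \<lfloor>y\<rfloor>))"
    by (simp add: fourier_char_def cis_mult frac_def algebra_simps)
  also have "cis (2 * pi * (k * \<lfloor>y\<rfloor>)) = 1"
    using cis_multiple_2pi[of "of_int (k * \<lfloor>y\<rfloor>)"] by simp
  finally show ?thesis by simp
qed

lemma integral_fourier_char:
  "(LBINT y:{0..1}. fourier_char k y) = (if k = 0 then 1 else 0)"
proof (cases "k = 0")
  case False
  define c where "c = 2 * pi * k * \<i>"
  have "c \<noteq> 0" using False by (simp add: c_def)
  have fc: "fourier_char k = (\<lambda>y. exp (c * y))"
    by (simp add: fun_eq_iff fourier_char_def cis_conv_exp c_def mult_ac)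
  have "((\<lambda>y::real. exp (c * y)) has_integral (exp (c * of_real 1) / c - exp (c * of_real 0) / c)) {0..1}"
  proof (rule fundamental_theorem_of_calculus)
    fix y :: real
    show "((\<lambda>y. exp (c * complex_of_real y) / c) has_vector_derivative exp (c * complex_of_real y)) (at y within {0..1})"
      using \<open>c \<noteq> 0\<close> by (auto intro!: derivative_eq_intros has_vector_derivative_real_field)
  qed simp
  moreover have "exp c = 1"
    using fourier_char_frac[of k 1] fc by simp
  ultimately have "integral {0..1} (fourier_char k) = 0"
    by (auto simp: fc intro: integral_unique)
  then show ?thesis
    using False by (subst set_borel_integral_eq_integral)
      (auto intro!: borel_integrable_atLeastAtMost' continuous_intros)
qed (simp add: set_integral_const)

text \<open>Replacing \<open>f\<close> by \<open>g\<close> changes every mean and the integral by at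
  most \<open>e / 3\<close>. Approximants whose means are already known to converge therefore
  suffice.\<close>

lemma mean_tendsto_uniform_approx:
  fixes y :: "nat \<Rightarrow> real" and f :: "real \<Rightarrow> real"
  assumes y: "\<And>n. y n \<in> {0..1}" and f: "continuous_on {0..1} f"
    and approx: "\<And>e. 0 < e \<Longrightarrow> \<exists>g. continuous_on {0..1} g \<and> (\<forall>x\<in>{0..1}. \<bar>f x - g x\<bar> \<le> e) \<and>
      (\<lambda>N. (\<Sum>n=1..N. g (y n)) / N) \<longlonglongrightarrow> (LBINT x:{0..1}. g x)"
  shows "(\<lambda>N. (\<Sum>n=1..N. f (y n)) / N) \<longlonglongrightarrow> (LBINT x:{0..1}. f x)"
proof (rule LIMSEQ_I)
  fix e :: real assume "0 < e"
  then obtain g where g: "continuous_on {0..1} g" "\<And>x. x \<in> {0..1} \<Longrightarrow> \<bar>f x - g x\<bar> \<le> e / 3"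
    and lim: "(\<lambda>N. (\<Sum>n=1..N. g (y n)) / N) \<longlonglongrightarrow> (LBINT x:{0..1}. g x)"
    using approx[of "e / 3"] by auto
  from LIMSEQ_D[OF lim, of "e / 3"] \<open>0 < e\<close> obtain N0
    where N0: "\<And>N. N \<ge> N0 \<Longrightarrow> \<bar>(\<Sum>n=1..N. g (y n)) / N - (LBINT x:{0..1}. g x)\<bar> < e / 3"
    by auto
  have int: "set_integrable lborel {0..1} f" "set_integrable lborel {0..1} g"
    using f g by (auto intro: borel_integrable_atLeastAtMost')
  have "continuous_on {0..1} (\<lambda>x. f x - g x)" using f g by (intro continuous_intros)
  then have int': "set_integrable lborel {0..1} (\<lambda>x. f x - g x)"
    by (rule borel_integrable_atLeastAtMost')
  have "\<bar>LBINT x:{0..1}. (f x - g x)\<bar> \<le> (LBINT x:{0..1}. \<bar>f x - g x\<bar>)"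
    using set_integral_norm_bound[OF int'] by simp
  also have "\<dots> \<le> (LBINT x:{0..1::real}. e / 3)"
    using g(2) int' by (intro set_integral_mono set_integrable_abs)
      (auto intro: borel_integrable_atLeastAtMost')
  finally have "\<bar>LBINT x:{0..1}. (f x - g x)\<bar> \<le> e / 3"
    by (simp add: set_integral_const)
  then have a: "\<bar>(LBINT x:{0..1}. f x) - (LBINT x:{0..1}. g x)\<bar> \<le> e / 3"
    using int by simp
  have b: "\<bar>(\<Sum>n=1..N. f (y n)) / N - (\<Sum>n=1..N. g (y n)) / N\<bar> \<le> e / 3" for N :: nat
  proof (cases "N = 0")
    case False
    have "\<bar>\<Sum>n=1..N. f (y n) - g (y n)\<bar> \<le> (\<Sum>n=1..N. e / 3)"
      using y g(2) by (intro order.trans[OF sum_abs] sum_mono) auto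
    then show ?thesis
      using False by (simp add: sum_subtractf field_simps flip: diff_divide_distrib)
  qed (use \<open>0 < e\<close> in simp)
  show "\<exists>N0. \<forall>N\<ge>N0. norm ((\<Sum>n=1..N. f (y n)) / N - (LBINT x:{0..1}. f x)) < e"
  proof (intro exI allI impI)
    fix N assume "N \<ge> N0"
    from N0[OF this] a b[of N] show "norm ((\<Sum>n=1..N. f (y n)) / N - (LBINT x:{0..1}. f x)) < e"
      by (simp only: real_norm_def)
  qed
qed

section \<open>Equidistribution of a sequence in the unit interval\<close>

locale vanishing_weyl_sums =
  fixes y :: "nat \<Rightarrow> real"
  assumes unit: "y n \<in> {0..1}"
    and weyl: "k \<noteq> 0 \<Longrightarrow> (\<lambda>N. (\<Sum>n=1..N. fourier_char k (y n)) / of_nat N) \<longlonglongrightarrow> 0"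
begin

text \<open>Twisting by all characters makes this property stable under multiplication by
  \<^term>\<open>fourier_char k\<close>, hence under multiplication by any polynomial in the real and imaginary
  parts of \<open>cis (2 * pi * x)\<close>.\<close>

definition twisted_means_converge :: "(real \<Rightarrow> complex) \<Rightarrow> bool" where
  "twisted_means_converge g \<longleftrightarrow> continuous_on UNIV g \<and>
     (\<forall>k. (\<lambda>N. (\<Sum>n=1..N. g (y n) * fourier_char k (y n)) / of_nat N)
       \<longlonglongrightarrow> (LBINT x:{0..1}. g x * fourier_char k x))"

lemma twisted_means_converge_1: "twisted_means_converge (\<lambda>x. 1)"
  unfolding twisted_means_converge_def
proof (intro conjI allI)
  fix k
  have "(\<lambda>N. (\<Sum>n=1..N. fourier_char 0 (y n)) / of_nat N) \<longlonglongrightarrow> 1"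
    by (rule tendsto_eventually) (auto intro!: eventually_sequentiallyI[of 1])
  then show "(\<lambda>N. (\<Sum>n=1..N. 1 * fourier_char k (y n)) / of_nat N)
      \<longlonglongrightarrow> (LBINT x:{0..1}. 1 * fourier_char k x)"
    using weyl[of k] by (cases "k = 0") (simp_all add: integral_fourier_char del: fourier_char_0)
qed simp

lemma twisted_means_converge_add:
  assumes "twisted_means_converge g" "twisted_means_converge h"
  shows "twisted_means_converge (\<lambda>x. g x + h x)"
  unfolding twisted_means_converge_def
proof (intro conjI allI)
  show "continuous_on UNIV (\<lambda>x. g x + h x)"
    using assms by (auto simp: twisted_means_converge_def intro: continuous_intros)
  fix k
  have "set_integrable lborel {0..1} (\<lambda>x. u x * fourier_char k x)" if "twisted_means_converge u" for u
    using that by (intro borel_integrable_atLeastAtMost')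
      (auto simp: twisted_means_converge_def intro!: continuous_intros intro: continuous_on_subset)
  then have "(LBINT x:{0..1}. (g x + h x) * fourier_char k x)
      = (LBINT x:{0..1}. g x * fourier_char k x) + (LBINT x:{0..1}. h x * fourier_char k x)"
    using assms by (simp add: distrib_right)
  moreover have "(\<lambda>N. (\<Sum>n=1..N. g (y n) * fourier_char k (y n)) / of_nat N
        + (\<Sum>n=1..N. h (y n) * fourier_char k (y n)) / of_nat N)
      \<longlonglongrightarrow> (LBINT x:{0..1}. g x * fourier_char k x) + (LBINT x:{0..1}. h x * fourier_char k x)"
    using assms by (intro tendsto_add) (auto simp: twisted_means_converge_def)
  ultimately show "(\<lambda>N. (\<Sum>n=1..N. (g (y n) + h (y n)) * fourier_char k (y n)) / of_nat N)
      \<longlonglongrightarrow> (LBINT x:{0..1}. (g x + h x) * fourier_char k x)"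
    by (simp add: distrib_right sum.distrib add_divide_distrib)
qed

lemma twisted_means_converge_char:
  assumes "twisted_means_converge g"
  shows "twisted_means_converge (\<lambda>x. c * fourier_char j x * g x)"
  unfolding twisted_means_converge_def
proof (intro conjI allI)
  show "continuous_on UNIV (\<lambda>x. c * fourier_char j x * g x)"
    using assms by (auto simp: twisted_means_converge_def intro!: continuous_intros)
  fix k
  have eq: "c * fourier_char j x * g x * fourier_char k x = c * (g x * fourier_char (j + k) x)" for x
    by (simp add: fourier_char_add)
  have "(\<lambda>N. c * ((\<Sum>n=1..N. g (y n) * fourier_char (j + k) (y n)) / of_nat N))
      \<longlonglongrightarrow> c * (LBINT x:{0..1}. g x * fourier_char (j + k) x)"
    using assms by (intro tendsto_mult_left) (auto simp: twisted_means_converge_def)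
  then show "(\<lambda>N. (\<Sum>n=1..N. c * fourier_char j (y n) * g (y n) * fourier_char k (y n)) / of_nat N)
      \<longlonglongrightarrow> (LBINT x:{0..1}. c * fourier_char j x * g x * fourier_char k x)"
    unfolding eq by (simp add: sum_distrib_left)
qed

text \<open>On the unit circle a real-linear function of \<open>z\<close> is a combination of
  \<open>z\<close> and its inverse, that is, of the characters of frequency 1 and -1. With
  \<open>g\<close> arbitrary in the induction, a product is handled by multiplying by one factor
  after the other.\<close>

lemma twisted_means_converge_polynomial:
  assumes "real_polynomial_function q" "twisted_means_converge g"
  shows "twisted_means_converge (\<lambda>x. of_real (q (fourier_char 1 x)) * g x)"
  using assms
proof (induction arbitrary: g rule: real_polynomial_function.induct)
  case (linear q)
  then interpret bounded_linear q by simp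
  have "complex_of_real (q (fourier_char 1 x))
      = (q 1 - \<i> * q \<i>) / 2 * fourier_char 1 x + (q 1 + \<i> * q \<i>) / 2 * fourier_char (-1) x" for x
  proof -
    have "q (fourier_char 1 x) = q (cos (2*pi*x) *\<^sub>R 1 + sin (2*pi*x) *\<^sub>R \<i>)"
      by (rule arg_cong[of _ _ q]) (simp add: complex_eq_iff fourier_char_def)
    also have "\<dots> = cos (2*pi*x) * q 1 + sin (2*pi*x) * q \<i>"
      by (simp only: add scale real_scaleR_def)
    finally show ?thesis
      by (simp add: complex_eq_iff fourier_char_def field_simps)
  qed
  then have "complex_of_real (q (fourier_char 1 x)) * g x
      = (q 1 - \<i> * q \<i>) / 2 * fourier_char 1 x * g x + (q 1 + \<i> * q \<i>) / 2 * fourier_char (-1) x * g x" for x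
    by (simp only: distrib_right)
  then show ?case
    using linear.prems by (simp only:) (intro twisted_means_converge_add twisted_means_converge_char)
next
  case (const c)
  from twisted_means_converge_char[OF const, of "of_real c" 0] show ?case by simp
next
  case (add q r)
  from twisted_means_converge_add[OF add.IH(1)[OF add.prems] add.IH(2)[OF add.prems]]
  show ?case by (simp add: distrib_right)
next
  case (mult q r)
  from mult.IH(1)[OF mult.IH(2)[OF mult.prems]] show ?case by (simp add: mult.assoc)
qed

lemma means_converge_polynomial:
  assumes "real_polynomial_function q"
  shows "(\<lambda>N. (\<Sum>n=1..N. q (fourier_char 1 (y n))) / N) \<longlonglongrightarrow> (LBINT x:{0..1}. q (fourier_char 1 x))"
proof -
  have "(\<lambda>N. (\<Sum>n=1..N. complex_of_real (q (fourier_char 1 (y n))) * fourier_char 0 (y n)) / of_nat N)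
     \<longlonglongrightarrow> (LBINT x:{0..1}. complex_of_real (q (fourier_char 1 x)) * fourier_char 0 x)"
    using twisted_means_converge_polynomial[OF assms twisted_means_converge_1]
    unfolding twisted_means_converge_def by (simp only: mult_1_right)
  from tendsto_Re[OF this] show ?thesis
    by (simp add: set_integral_complex_of_real flip: of_real_sum)
qed

text \<open>Since \<open>f 0 = f 1\<close>, \<open>f\<close> factors through the circle, where
  Stone-Weierstrass approximates it by polynomials in the two real coordinates.\<close>

lemma means_converge_periodic:
  fixes f :: "real \<Rightarrow> real"
  assumes f: "continuous_on {0..1} f" and "f 0 = f 1"
  shows "(\<lambda>N. (\<Sum>n=1..N. f (y n)) / N) \<longlonglongrightarrow> (LBINT x:{0..1}. f x)"
proof (rule mean_tendsto_uniform_approx[OF unit f])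
  define S where "S = fourier_char 1 ` {0..1}"
  \<comment> \<open>The choice matters only at \<open>z = 1\<close>, whose preimages 0 and 1 give
    the same value of \<open>f\<close>.\<close>
  define F where "F z = f (SOME x. x \<in> {0..1} \<and> fourier_char 1 x = z)" for z
  have F: "F (fourier_char 1 x) = f x" if x: "x \<in> {0..1}" for x
  proof -
    define x' where "x' = (SOME x'. x' \<in> {0..1} \<and> fourier_char 1 x' = fourier_char 1 x)"
    have "x' \<in> {0..1} \<and> fourier_char 1 x' = fourier_char 1 x"
      unfolding x'_def by (rule someI[of _ x]) (use x in simp)
    then have x': "x' \<in> {0..1}" "cis (2 * pi * x') = cis (2 * pi * x)"
      by (simp_all add: fourier_char_def)
    then obtain n :: int where "\<i> * complex_of_real (2 * pi * x')
        = \<i> * complex_of_real (2 * pi * x) + of_real (of_int (2 * n) * pi) * \<i>"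
      unfolding cis_conv_exp exp_eq by auto
    from arg_cong[OF this, of Im] have "2 * pi * x' = 2 * pi * (x + n)" by (simp add: algebra_simps)
    then have n: "x' = x + n" by simp
    with x x' have "n = 0 \<or> n = 1 \<or> n = -1" by auto
    then have "f x' = f x" using n x x' \<open>f 0 = f 1\<close> by auto
    then show ?thesis by (simp add: F_def x'_def)
  qed
  have "compact S"
    unfolding S_def by (intro compact_continuous_image continuous_intros) simp
  \<comment> \<open>The preimage of a closed set under \<open>F\<close> is the image under the
    character of a compact subset of the interval, hence closed.\<close>
  moreover have "continuous_on S F"
    unfolding continuous_on_closed_vimage[OF compact_imp_closed[OF \<open>compact S\<close>]]
  proof (intro allI impI)
    fix B :: "real set" assume "closed B"
    then have "closed (f -` B \<inter> {0..1})"
      using f by (auto simp: continuous_on_closed_vimage)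
    then have "compact (f -` B \<inter> {0..1})"
      by (auto intro: compact_Int_closed simp: compact_eq_bounded_closed bounded_Int)
    then have "closed (fourier_char 1 ` (f -` B \<inter> {0..1}))"
      by (intro compact_imp_closed compact_continuous_image continuous_intros)
    also have "fourier_char 1 ` (f -` B \<inter> {0..1}) = F -` B \<inter> S"
      using F by (auto simp: S_def image_iff)
    finally show "closed (F -` B \<inter> S)" .
  qed
  moreover fix e :: real assume "0 < e"
  ultimately obtain q where q: "real_polynomial_function q" "\<And>z. z \<in> S \<Longrightarrow> \<bar>F z - q z\<bar> < e"
    using Stone_Weierstrass_real_polynomial_function by blast
  show "\<exists>g. continuous_on {0..1} g \<and> (\<forall>x\<in>{0..1}. \<bar>f x - g x\<bar> \<le> e) \<and>
      (\<lambda>N. (\<Sum>n=1..N. g (y n)) / N) \<longlonglongrightarrow> (LBINT x:{0..1}. g x)"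
  proof (intro exI conjI ballI)
    show "continuous_on {0..1} (\<lambda>x. q (fourier_char 1 x))"
      using q(1) by (intro continuous_on_compose2[OF _ continuous_on_fourier_char, of UNIV q])
        (auto intro: continuous_real_polymonial_function continuous_at_imp_continuous_on)
    show "\<bar>f x - q (fourier_char 1 x)\<bar> \<le> e" if "x \<in> {0..1}" for x
      using q(2)[of "fourier_char 1 x"] that by (simp add: F S_def)
  qed (rule means_converge_polynomial[OF q(1)])
qed

text \<open>The identity takes different values at 0 and 1, so it is squeezed between
  \<open>x - x ^ m\<close> and \<open>x + (1 - x) ^ m\<close>. Each of these has equal values at 0
  and 1, and their integrals differ from 1/2 by \<open>1 / (m + 1)\<close>.\<close>

lemma means_converge_id: "(\<lambda>N. (\<Sum>n=1..N. y n) / N) \<longlonglongrightarrow> 1 / 2"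
proof (rule LIMSEQ_I)
  fix e :: real assume "0 < e"
  obtain j :: nat where "1 / Suc j < e / 2"
    using nat_approx_posE[of "e / 2"] \<open>0 < e\<close> by auto
  define m where "m = Suc j"
  have m: "1 / real (Suc m) < e / 2" "m > 0"
    using \<open>1 / Suc j < e / 2\<close> unfolding m_def
    by (auto intro!: le_less_trans[OF divide_left_mono[of "1 + real j" "2 + real j" 2]])
  define l u where "l x = x - x ^ m" and "u x = x + (1 - x) ^ m" for x :: real
  have cont: "continuous_on {0..1} l" "continuous_on {0..1} u"
    unfolding l_def u_def by (auto intro!: continuous_intros)
  have integral: "(LBINT x:{0..1}. g x) = G 1 - G 0"
    if "continuous_on {0..1} g" "\<And>x. (G has_real_derivative g x) (at x)" for g G :: "real \<Rightarrow> real"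
  proof -
    have "(g has_integral (G 1 - G 0)) {0..1}"
      using that(2) by (intro fundamental_theorem_of_calculus)
        (auto simp: has_real_derivative_iff_has_vector_derivative intro: has_vector_derivative_at_within)
    then show ?thesis
      using that(1) by (subst set_borel_integral_eq_integral)
        (auto intro: borel_integrable_atLeastAtMost' integral_unique)
  qed
  have "(LBINT x:{0..1}. l x) = 1 / 2 - 1 / real (Suc m)"
    using m(2) by (subst integral[where G = "\<lambda>x. x\<^sup>2 / 2 - x ^ Suc m / real (Suc m)"])
      (auto intro!: continuous_intros derivative_eq_intros simp: l_def simp del: power_Suc of_nat_Suc)
  moreover have "(LBINT x:{0..1}. u x) = 1 / 2 + 1 / real (Suc m)"
    using m(2) by (subst integral[where G = "\<lambda>x. x\<^sup>2 / 2 - (1 - x) ^ Suc m / real (Suc m)"])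
      (auto intro!: continuous_intros derivative_eq_intros simp: u_def simp del: power_Suc of_nat_Suc)
  ultimately have lim: "(\<lambda>N. (\<Sum>n=1..N. l (y n)) / N) \<longlonglongrightarrow> 1 / 2 - 1 / real (Suc m)"
    "(\<lambda>N. (\<Sum>n=1..N. u (y n)) / N) \<longlonglongrightarrow> 1 / 2 + 1 / real (Suc m)"
    using means_converge_periodic[OF cont(1)] means_converge_periodic[OF cont(2)] m(2)
    by (simp_all add: l_def u_def)
  have le: "(\<Sum>n=1..N. l (y n)) / N \<le> (\<Sum>n=1..N. y n) / N"
    "(\<Sum>n=1..N. y n) / N \<le> (\<Sum>n=1..N. u (y n)) / N" for N :: nat
    using unit by (auto intro!: divide_right_mono sum_mono simp: l_def u_def)
  have "\<forall>\<^sub>F N in sequentially. (\<Sum>n=1..N. l (y n)) / N > 1 / 2 - e"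
    "\<forall>\<^sub>F N in sequentially. (\<Sum>n=1..N. u (y n)) / N < 1 / 2 + e"
    using m(1) \<open>0 < e\<close> by (intro order_tendstoD[OF lim(1)] order_tendstoD[OF lim(2)]; linarith)+
  then have "\<forall>\<^sub>F N in sequentially. norm ((\<Sum>n=1..N. y n) / N - 1 / 2) < e"
  proof eventually_elim
    case (elim N)
    with le[of N] show ?case unfolding real_norm_def by linarith
  qed
  then show "\<exists>N0. \<forall>N\<ge>N0. norm ((\<Sum>n=1..N. y n) / N - 1 / 2) < e"
    by (simp add: eventually_sequentially)
qed

text \<open>Subtracting the multiple \<open>d * x\<close> of the identity makes the endpoint values
  equal, which reduces the claim to the two previous cases.\<close>

theorem means_converge:
  fixes f :: "real \<Rightarrow> real"
  assumes f: "continuous_on {0..1} f"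
  shows "(\<lambda>N. (\<Sum>n=1..N. f (y n)) / N) \<longlonglongrightarrow> (LBINT x:{0..1}. f x)"
proof -
  define d where "d = f 1 - f 0"
  define g where "g x = f x - d * x" for x
  have g: "continuous_on {0..1} g" "g 0 = g 1"
    unfolding g_def using f by (auto intro!: continuous_intros simp: d_def)
  have "((\<lambda>x. x) has_integral (((1::real)\<^sup>2 - 0\<^sup>2) / 2)) {0..1}"
    by (rule ident_has_integral) simp
  then have "(LBINT x:{0..1}. x) = 1 / (2::real)"
    by (subst set_borel_integral_eq_integral)
      (auto intro!: borel_integrable_atLeastAtMost' continuous_intros integral_unique)
  moreover have "(LBINT x:{0..1}. f x) = (LBINT x:{0..1}. g x + d * x)"
    by (simp add: g_def)
  moreover have "\<dots> = (LBINT x:{0..1}. g x) + (LBINT x:{0..1}. d * x)"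
    using g by (intro set_integral_add borel_integrable_atLeastAtMost' continuous_intros)
  ultimately have "(LBINT x:{0..1}. f x) = (LBINT x:{0..1}. g x) + d * (1 / 2)"
    by simp
  moreover have "(\<lambda>N. (\<Sum>n=1..N. g (y n)) / N + d * ((\<Sum>n=1..N. y n) / N))
      \<longlonglongrightarrow> (LBINT x:{0..1}. g x) + d * (1 / 2)"
    by (intro tendsto_add tendsto_mult_left means_converge_periodic means_converge_id g)
  ultimately show ?thesis
    by (simp add: g_def sum_subtractf sum_distrib_left diff_divide_distrib)
qed

end

text \<open>The zeroth iterate is \<open>x\<close> itself, not reduced mod 1, hence
  \<open>0 < n\<close>. Later reductions change the point only by integers, which multiplication by
  \<open>b\<close> preserves.\<close>

lemma funpow_times_mod_one:
  assumes "0 < n"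
  shows "(times_mod_one b ^^ n) x = frac (real b ^ n * x)"
  using assms
proof (induction n rule: nat_induct_non_zero)
  case (Suc n)
  define z where "z = real b ^ n * x"
  have "real b * frac z = real b * z + of_int (- (int b * \<lfloor>z\<rfloor>))"
    by (simp add: frac_def algebra_simps)
  then have "frac (real b * frac z) = frac (real b * z)"
    by (simp only: frac_add_of_int_right)
  then show ?case
    using Suc by (simp add: times_mod_one_def z_def mult.assoc)
qed (simp add: times_mod_one_def)

text \<open>All orbit points with \<open>n \<ge> 1\<close> lie in \<open>{0..1}\<close>, so the
  restriction to this interval loses no mass. Continuity of \<open>f\<close> is known only there, so
  measurability is that of its product with the indicator.\<close>

lemma integral_empirical_measure:
  assumes f: "continuous_on {0..1} f"
  shows "(LINT x:{0..1}|empirical_measure b z N. f x) = (\<Sum>n=1..N. f (frac (real b ^ n * z))) / N"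
proof -
  have meas: "(\<lambda>x. indicator {0..1} x * f x) \<in> borel_measurable borel"
    using borel_measurable_continuous_on_indicator[OF _ f] by simp
  have "integrable (return borel a) (\<lambda>x. indicator {0..1} x *\<^sub>R f x)" for a :: real
    using meas by (simp add: integrable_iff_bounded nn_integral_return)
  moreover have "0 \<le> frac a" "frac a \<le> 1" for a :: real
    using frac_lt_1[of a] by auto
  ultimately show ?thesis
    unfolding set_lebesgue_integral_def empirical_measure_def
    by (subst integral_lin_comb) (auto simp: meas integral_return funpow_times_mod_one sum_divide_distrib)
qed

lemma normal_to_base_if_weyl_sums_vanish:
  assumes "\<And>k. k \<noteq> 0 \<Longrightarrow>
    (\<lambda>N. (\<Sum>n=1..N. cis (2 * pi * real_of_int k * (real b ^ n * x))) / of_nat N) \<longlonglongrightarrow> 0"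
  shows "normal_to_base b x"
  unfolding normal_to_base_def weak_star_conv_on_def
proof (intro allI impI)
  interpret vanishing_weyl_sums "\<lambda>n. frac (real b ^ n * x)"
    using assms by unfold_locales
      (auto simp: fourier_char_frac, simp_all add: fourier_char_def less_imp_le[OF frac_lt_1])
  fix f :: "real \<Rightarrow> real" assume f: "continuous_on {0..1} f"
  have meas: "(\<lambda>x. indicator {0..1} x * f x) \<in> borel_measurable borel"
    using borel_measurable_continuous_on_indicator[OF _ f] by simp
  have "(LINT x:{0..1}|lebesgue_unit. f x) = (LBINT x:{0..1}. f x)"
    unfolding lebesgue_unit_def set_lebesgue_integral_def ennreal_indicator[symmetric]
    by (subst integral_density)
      (auto simp: meas intro!: Bochner_Integration.integral_cong split: split_indicator)
  then show "(\<lambda>N. LINT x:{0..1}|empirical_measure b x N. f x)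
      \<longlonglongrightarrow> (LINT x:{0..1}|lebesgue_unit. f x)"
    using means_converge[OF f] by (simp add: integral_empirical_measure f)
qed

section \<open>Second moments and sparse means\<close>

text \<open>A chord of the unit circle is no longer than its arc.\<close>

lemma norm_cis_diff_le: "norm (cis u - cis v) \<le> \<bar>u - v\<bar>"
proof -
  have "cis u - cis v = cis v * (cis (u - v) - 1)"
    by (simp add: right_diff_distrib cis_mult)
  then have "norm (cis u - cis v) = norm (exp (\<i> * of_real (u - v)) - 1)"
    by (simp add: norm_mult cis_conv_exp)
  also have "\<dots> \<le> \<bar>u - v\<bar>"
    using abs_sin_x_le_abs_x[of "(u - v) / 2"] by (simp only: dist_exp_i_1) simp
  finally show ?thesis .
qed

text \<open>The surviving terms grow by a factor of at least 2 and the last one is at most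
  \<open>Q\<close>, so the bound does not depend on \<open>N\<close>.\<close>

lemma sum_geometric_capped:
  fixes N b :: nat and c Q :: real
  assumes "2 \<le> b" "0 \<le> c" "0 \<le> Q"
  shows "(\<Sum>n=1..N. if c * b ^ n \<le> Q then c * b ^ n else 0) \<le> 2 * Q"
proof (induction N)
  case (Suc N)
  show ?case
  proof (cases "c * b ^ Suc N \<le> Q")
    case True
    have geom: "(\<Sum>n=1..M. real b ^ n) \<le> 2 * b ^ M" for M
    proof (induction M)
      case (Suc M)
      have "2 * real b ^ M \<le> b ^ Suc M" using \<open>2 \<le> b\<close> by simp
      then show ?case using Suc by simp
    qed simp
    have "(\<Sum>n=1..Suc N. if c * b ^ n \<le> Q then c * b ^ n else 0) \<le> (\<Sum>n=1..Suc N. c * b ^ n)"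
      using assms by (intro sum_mono) auto
    also have "\<dots> = c * (\<Sum>n=1..Suc N. real b ^ n)"
      by (simp only: sum_distrib_left of_nat_power)
    also have "\<dots> \<le> c * (2 * b ^ Suc N)"
      using \<open>0 \<le> c\<close> by (intro mult_left_mono geom)
    finally show ?thesis using True by simp
  qed (use Suc in simp)
qed (use assms in simp)

lemma norm_add_square: "(norm (w + z))\<^sup>2 = (norm w)\<^sup>2 + 2 * Re (cnj w * z) + (norm z)\<^sup>2" for w z :: complex
  by (simp only: cmod_power2 plus_complex.sel) (simp add: power2_eq_square algebra_simps)

text \<open>Pythagoras: the cross term is linear in \<open>Y\<close> and integrates to 0. This
  serves the last generation of cylinders.\<close>

lemma (in prob_space) integral_square_add_centered:
  fixes Y :: "'a \<Rightarrow> complex"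
  assumes Y: "integrable M Y" "(CLINT x|M. Y x) = 0" and C: "AE x in M. norm (Y x) \<le> C"
  shows "(\<integral>x. (norm (w + Y x))\<^sup>2 \<partial>M) \<le> (norm w)\<^sup>2 + C\<^sup>2"
proof -
  have [measurable]: "Y \<in> borel_measurable M" using Y(1) by simp
  have sq: "AE x in M. (norm (Y x))\<^sup>2 \<le> C\<^sup>2"
    using C by eventually_elim (rule power_mono, simp_all)
  then have int: "integrable M (\<lambda>x. (norm (Y x))\<^sup>2)"
    by (intro integrable_const_bound[where B="C\<^sup>2"]) auto
  have "(\<integral>x. (norm (w + Y x))\<^sup>2 \<partial>M)
      = (\<integral>x. (norm w)\<^sup>2 + 2 * Re (cnj w * Y x) + (norm (Y x))\<^sup>2 \<partial>M)"
    by (simp only: norm_add_square)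
  also have "\<dots> = (norm w)\<^sup>2 + 2 * Re (CLINT x|M. cnj w * Y x) + (\<integral>x. (norm (Y x))\<^sup>2 \<partial>M)"
    using Y(1) int prob_space by (simp del: times_complex.sel)
  also have "\<dots> \<le> (norm w)\<^sup>2 + (\<integral>x. C\<^sup>2 \<partial>M)"
    using Y integral_mono_AE[OF int _ sq] by (simp del: times_complex.sel)
  finally show ?thesis using prob_space by simp
qed

text \<open>The same orthogonality for one martingale step, where \<open>D i\<close> is the
  increment on choosing the child \<open>i\<close>.\<close>

lemma weighted_square_add_centered:
  fixes D :: "nat \<Rightarrow> complex" and p :: "nat \<Rightarrow> real"
  assumes p: "\<And>i. i < l \<Longrightarrow> 0 \<le> p i" "(\<Sum>i<l. p i) = 1"
    and D: "(\<Sum>i<l. p i * D i) = 0"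
    and C: "\<And>i. i < l \<Longrightarrow> norm (D i) \<le> C"
  shows "(\<Sum>i<l. p i * (norm (w + D i))\<^sup>2) \<le> (norm w)\<^sup>2 + C\<^sup>2"
proof -
  have "(\<Sum>i<l. p i * Re (cnj w * D i)) = Re (\<Sum>i<l. cnj w * (p i * D i))"
    by (simp add: algebra_simps)
  also have "\<dots> = 0"
    using D by (simp only: sum_distrib_left[symmetric]) simp
  finally have cross: "(\<Sum>i<l. p i * Re (cnj w * D i)) = 0" .
  have "(\<Sum>i<l. p i * (norm (w + D i))\<^sup>2)
      = (\<Sum>i<l. p i * (norm w)\<^sup>2 + 2 * (p i * Re (cnj w * D i)) + p i * (norm (D i))\<^sup>2)"
    by (simp only: norm_add_square distrib_left mult.left_commute)
  also have "\<dots> = (norm w)\<^sup>2 + (\<Sum>i<l. p i * (norm (D i))\<^sup>2)"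
    using cross p(2) by (simp add: sum.distrib del: times_complex.sel flip: sum_distrib_left sum_distrib_right)
  also have "(\<Sum>i<l. p i * (norm (D i))\<^sup>2) \<le> (\<Sum>i<l. p i * C\<^sup>2)"
    using C p(1) by (intro sum_mono mult_left_mono power_mono) auto
  finally show ?thesis using p(2) by (simp flip: sum_distrib_right)
qed

text \<open>If \<open>j\<^sup>2\<close> is the largest square up to \<open>N\<close>, at most
  \<open>2 * j\<close> further terms remain; these contribute at most \<open>2 / sqrt N\<close> to
  the mean.\<close>

lemma means_tendsto_zero_if_square_means:
  fixes z :: "nat \<Rightarrow> complex"
  assumes z: "\<And>n. norm (z n) \<le> 1"
    and lim: "(\<lambda>j. norm (\<Sum>n=1..j\<^sup>2. z n) / real (j\<^sup>2)) \<longlonglongrightarrow> 0"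
  shows "(\<lambda>N. (\<Sum>n=1..N. z n) / of_nat N) \<longlonglongrightarrow> 0"
proof (rule Lim_null_comparison)
  define j where "j N = nat \<lfloor>sqrt (real N)\<rfloor>" for N
  have "filterlim j at_top sequentially"
    unfolding j_def
    by (intro filterlim_compose[OF filterlim_nat_sequentially]
        filterlim_compose[OF filterlim_floor_sequentially]
        filterlim_compose[OF sqrt_at_top] filterlim_real_sequentially)
  then have "(\<lambda>N. norm (\<Sum>n=1..(j N)\<^sup>2. z n) / real ((j N)\<^sup>2)) \<longlonglongrightarrow> 0"
    by (rule filterlim_compose[OF lim])
  moreover have "(\<lambda>N. 2 / sqrt (real N)) \<longlonglongrightarrow> 0"
    by (intro tendsto_divide_0[OF tendsto_const] filterlim_at_top_imp_at_infinity
        filterlim_compose[OF sqrt_at_top] filterlim_real_sequentially)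
  ultimately show "(\<lambda>N. norm (\<Sum>n=1..(j N)\<^sup>2. z n) / real ((j N)\<^sup>2) + 2 / sqrt (real N)) \<longlonglongrightarrow> 0"
    using tendsto_add by fastforce
  show "\<forall>\<^sub>F N in sequentially. norm ((\<Sum>n=1..N. z n) / of_nat N)
      \<le> norm (\<Sum>n=1..(j N)\<^sup>2. z n) / real ((j N)\<^sup>2) + 2 / sqrt (real N)"
  proof (rule eventually_sequentiallyI)
    fix N :: nat assume "1 \<le> N"
    then have "1 \<le> sqrt (real N)" by simp
    then have j: "1 \<le> j N" "real (j N) \<le> sqrt N" "sqrt N < real (j N) + 1"
      unfolding j_def by (simp_all add: le_nat_iff)
    have "(real (j N))\<^sup>2 \<le> (sqrt N)\<^sup>2" "(sqrt N)\<^sup>2 < (real (j N) + 1)\<^sup>2"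
      using j by (intro power_mono power_strict_mono; simp)+
    then have N: "real ((j N)\<^sup>2) \<le> N" "N < real ((j N)\<^sup>2) + 2 * j N + 1"
      by (simp_all add: power2_sum)
    then have le: "(j N)\<^sup>2 \<le> N" "N \<le> (j N)\<^sup>2 + 2 * j N"
      by linarith+
    have split: "(\<Sum>n=1..N. z n) = (\<Sum>n=1..(j N)\<^sup>2. z n) + (\<Sum>n=(j N)\<^sup>2+1..N. z n)"
      using le(1) sum.ub_add_nat[of 1 "(j N)\<^sup>2" z "N - (j N)\<^sup>2"] by simp
    have "norm (\<Sum>n=(j N)\<^sup>2+1..N. z n) \<le> real (card {(j N)\<^sup>2+1..N}) * 1"
      using z by (intro sum_norm_bound)
    moreover have "card {(j N)\<^sup>2+1..N} \<le> 2 * j N"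
      using le by simp
    then have "real (card {(j N)\<^sup>2+1..N}) \<le> 2 * sqrt N"
      using j(2) by linarith
    ultimately have "norm (\<Sum>n=1..N. z n) \<le> norm (\<Sum>n=1..(j N)\<^sup>2. z n) + 2 * sqrt N"
      unfolding split
      using norm_triangle_ineq[of "\<Sum>n=1..(j N)\<^sup>2. z n" "\<Sum>n=(j N)\<^sup>2+1..N. z n"] by linarith
    then have "norm (\<Sum>n=1..N. z n) / N \<le> norm (\<Sum>n=1..(j N)\<^sup>2. z n) / N + 2 * sqrt N / N"
      by (simp add: divide_right_mono flip: add_divide_distrib)
    also have "2 * sqrt N / N = 2 / sqrt N"
      using \<open>1 \<le> N\<close> by (simp add: field_simps)
    also have "norm (\<Sum>n=1..(j N)\<^sup>2. z n) / N \<le> norm (\<Sum>n=1..(j N)\<^sup>2. z n) / real ((j N)\<^sup>2)"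
      using j N(1) \<open>1 \<le> N\<close> by (intro divide_left_mono) auto
    finally show "norm ((\<Sum>n=1..N. z n) / of_nat N)
      \<le> norm (\<Sum>n=1..(j N)\<^sup>2. z n) / real ((j N)\<^sup>2) + 2 / sqrt (real N)"
      by (simp add: norm_divide)
  qed
qed

section \<open>Self-similar measures\<close>

text \<open>\<open>r\<close> and \<open>T\<close> bound the support, \<open>r\<close> also the
  number of generations needed to reach a given scale, and \<open>\<delta>\<close> how far one
  generation can jump below that scale.\<close>

locale self_similar_distribution = real_distribution \<nu>
  for \<nu> +
  fixes l :: nat and s t p :: "nat \<Rightarrow> real" and \<delta> r T :: real
  assumes self_similar: "\<nu> = lin_comb {..<l} p (\<lambda>i. distr \<nu> borel (ifs_map s t i))"
    and weight_nonneg: "i < l \<Longrightarrow> 0 \<le> p i" and sum_weights: "(\<Sum>i<l. p i) = 1"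
    and ratio_lower: "0 < \<delta>" "i < l \<Longrightarrow> \<delta> \<le> \<bar>s i\<bar>"
    and ratio_upper: "0 < r" "r < 1" "i < l \<Longrightarrow> \<bar>s i\<bar> \<le> r"
    and translation: "0 \<le> T" "i < l \<Longrightarrow> \<bar>t i\<bar> \<le> T"
begin

lemma integral_self_similar:
  fixes f :: "real \<Rightarrow> real"
  assumes [measurable]: "f \<in> borel_measurable borel" and bound: "\<And>x. \<bar>f x\<bar> \<le> B"
  shows "(\<integral>x. f x \<partial>\<nu>) = (\<Sum>i<l. p i * (\<integral>x. f (s i * x + t i) \<partial>\<nu>))"
proof -
  have [measurable]: "ifs_map s t i \<in> borel_measurable borel" for i
    unfolding ifs_map_def by simp
  have "integrable (distr \<nu> borel (ifs_map s t i)) f" for i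
    by (subst integrable_distr_eq) (auto intro!: integrable_const_bound[where B=B] simp: bound)
  then have "(\<integral>x. f x \<partial>lin_comb {..<l} p (\<lambda>i. distr \<nu> borel (ifs_map s t i)))
      = (\<Sum>i<l. p i * (\<integral>x. f x \<partial>distr \<nu> borel (ifs_map s t i)))"
    by (intro integral_lin_comb) (auto simp: weight_nonneg)
  then show ?thesis
    by (simp add: integral_distr ifs_map_def flip: self_similar)
qed

lemma integrable_bounded_borel:
  fixes f :: "real \<Rightarrow> 'b::{banach, second_countable_topology}"
  assumes "f \<in> borel_measurable borel" "\<And>x. norm (f x) \<le> B"
  shows "integrable \<nu> f"
  using assms by (intro integrable_const_bound[where B=B]) auto

lemma complex_integral_self_similar:
  fixes f :: "real \<Rightarrow> complex"
  assumes [measurable]: "f \<in> borel_measurable borel" and bound: "\<And>x. norm (f x) \<le> B"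
  shows "(\<integral>x. f x \<partial>\<nu>) = (\<Sum>i<l. p i * (\<integral>x. f (s i * x + t i) \<partial>\<nu>))"
proof -
  have int: "integrable \<nu> f" "integrable \<nu> (\<lambda>x. f (s i * x + t i))" for i
    using bound by (auto intro!: integrable_bounded_borel[where B=B])
  have "\<bar>Re (f x)\<bar> \<le> B" "\<bar>Im (f x)\<bar> \<le> B" for x
    using abs_Re_le_cmod[of "f x"] abs_Im_le_cmod[of "f x"] bound[of x] by linarith+
  then show ?thesis
    using integral_self_similar[of "\<lambda>x. Re (f x)" B] integral_self_similar[of "\<lambda>x. Im (f x)" B] int
    by (simp add: complex_eq_iff)
qed

text \<open>The solution \<open>R\<close> of \<open>R = r * R + T\<close>, so that every map sends
  the interval from \<open>-R\<close> to \<open>R\<close> into itself.\<close>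

definition radius :: real where "radius = T / (1 - r)"

lemma radius_nonneg: "0 \<le> radius"
  using translation ratio_upper by (simp add: radius_def)

lemma map_le_radius:
  assumes "i < l"
  shows "\<bar>s i * x + t i\<bar> - radius \<le> r * (\<bar>x\<bar> - radius)"
proof -
  have "\<bar>s i * x + t i\<bar> \<le> \<bar>s i\<bar> * \<bar>x\<bar> + \<bar>t i\<bar>"
    by (metis abs_mult abs_triangle_ineq)
  also have "\<dots> \<le> r * \<bar>x\<bar> + T"
    using assms ratio_upper translation by (intro add_mono mult_right_mono) auto
  also have "T = radius - r * radius"
    using ratio_upper nonzero_mult_div_cancel_left[of "1 - r" T]
    by (simp add: radius_def left_diff_distrib flip: diff_divide_distrib)
  finally show ?thesis by (simp add: algebra_simps)
qed

lemma map_within_radius: "i < l \<Longrightarrow> \<bar>x\<bar> \<le> radius \<Longrightarrow> \<bar>s i * x + t i\<bar> \<le> radius"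
  using map_le_radius[of i x] mult_nonneg_nonpos[of r "\<bar>x\<bar> - radius"] ratio_upper by simp

text \<open>By \<open>map_le_radius\<close> a point can be sent farther than \<open>a\<close>
  outside the radius only if it was farther than \<open>a / r\<close> outside. Invariance then
  bounds the mass of \<open>A a\<close> by that of \<open>A (a / r ^ n)\<close>, and these sets
  decrease to the empty set.\<close>

lemma AE_within_radius: "AE x in \<nu>. \<bar>x\<bar> \<le> radius"
proof -
  define A where "A a = {x. radius + a < \<bar>x\<bar>}" for a
  have [measurable]: "A a \<in> sets borel" for a unfolding A_def by measurable
  have step: "prob (A a) \<le> prob (A (a / r))" for a
  proof -
    have "prob (A a) = (\<Sum>i<l. p i * (\<integral>x. indicator (A a) (s i * x + t i) \<partial>\<nu>))"
      using integral_self_similar[of "indicator (A a)" 1] by (simp add: indicator_abs_le_1)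
    also have "\<dots> \<le> (\<Sum>i<l. p i * (\<integral>x. indicator (A (a / r)) x \<partial>\<nu>))"
    proof (intro sum_mono mult_left_mono integral_mono)
      fix i x assume i: "i \<in> {..<l}"
      show "indicator (A a) (s i * x + t i) \<le> (indicator (A (a / r)) x :: real)"
        using map_le_radius[of i x] i ratio_upper by (auto simp: A_def field_simps split: split_indicator)
    qed (auto intro!: integrable_bounded_borel[where B=1] simp: weight_nonneg indicator_def)
    also have "\<dots> = prob (A (a / r))"
      by (simp add: sum_weights flip: sum_distrib_right)
    finally show ?thesis .
  qed
  have "prob (A a) = 0" if "0 < a" for a
  proof -
    have "prob (A a) \<le> prob (A (a / r ^ n))" for n
      using step[of "a / r ^ n" for n] 
      by (induction n) (auto intro: order.trans simp: divide_divide_eq_left mult.commute)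
    moreover have "(\<lambda>n. prob (A (a / r ^ n))) \<longlonglongrightarrow> prob (\<Inter>n. A (a / r ^ n))"
    proof (rule finite_Lim_measure_decseq)
      have "a / r ^ m \<le> a / r ^ n" if "m \<le> n" for m n
        using that ratio_upper \<open>0 < a\<close> by (intro divide_left_mono power_decreasing) auto
      then show "decseq (\<lambda>n. A (a / r ^ n))"
        by (force simp: decseq_def A_def)
    qed auto
    moreover have "(\<Inter>n. A (a / r ^ n)) = {}"
    proof -
      have "x \<notin> (\<Inter>n. A (a / r ^ n))" for x
      proof -
        obtain n where "r ^ n < a / (\<bar>x\<bar> + 1)"
          using real_arch_pow_inv[of "a / (\<bar>x\<bar> + 1)" r] ratio_upper \<open>0 < a\<close> by auto
        then have "\<bar>x\<bar> + 1 < a / r ^ n"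
          using ratio_upper by (simp add: field_simps)
        then have "x \<notin> A (a / r ^ n)"
          using radius_nonneg by (simp add: A_def)
        then show ?thesis by blast
      qed
      then show ?thesis by blast
    qed
    ultimately have "prob (A a) \<le> 0"
      using LIMSEQ_le_const by fastforce
    then show ?thesis by (simp add: measure_le_0_iff)
  qed
  \<comment> \<open>Countably many margins \<open>1 / Suc m\<close> exhaust the outside of the
    closed interval.\<close>
  then have "AE x in \<nu>. x \<notin> A (1 / Suc m)" for m
    by (intro AE_I'[of "A (1 / Suc m)"]) (auto simp: null_sets_def emeasure_eq_measure)
  then have "AE x in \<nu>. \<forall>m. x \<notin> A (1 / Suc m)"
    by (simp add: AE_all_countable)
  then show ?thesis
  proof eventually_elim
    case (elim x)
    show ?case
    proof (rule ccontr)
      assume "\<not> \<bar>x\<bar> \<le> radius"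
      then obtain m where "1 / Suc m < \<bar>x\<bar> - radius"
        using nat_approx_posE[of "\<bar>x\<bar> - radius"] by auto
      with spec[OF elim, of m] show False by (simp add: A_def)
    qed
  qed
qed

end

section \<open>The second moment bound\<close>

text \<open>The second threshold puts the frequency at which an index settles beyond
  \<open>q0\<close>: it is \<open>\<bar>a\<bar> * \<delta> * Q\<close> at least, since the parent
  was still above \<open>Q\<close>.\<close>

locale rajchman_self_similar = self_similar_distribution +
  fixes a \<epsilon> q0 Q :: real and b :: nat
  assumes base: "2 \<le> b" and eps: "0 \<le> \<epsilon>"
    and decay: "\<And>q. q0 \<le> \<bar>q\<bar> \<Longrightarrow> norm (CLINT x|\<nu>. cis (q * x)) \<le> \<epsilon>"
    and threshold: "1 \<le> Q" "q0 \<le> \<bar>a\<bar> * \<delta> * Q"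
begin

text \<open>The affine map \<open>x \<mapsto> \<sigma> * x + \<tau>\<close> stands for a composition of maps of the IFS, that is, for a
  cylinder; \<open>coef n \<sigma> \<tau>\<close> is the conditional expectation of \<open>wave n\<close> on that cylinder.\<close>

definition wave :: "nat \<Rightarrow> real \<Rightarrow> complex" where
  "wave n x = cis (a * b ^ n * x)"

definition coef :: "nat \<Rightarrow> real \<Rightarrow> real \<Rightarrow> complex" where
  "coef n \<sigma> \<tau> = (CLINT x|\<nu>. wave n (\<sigma> * x + \<tau>))"

text \<open>Seen from the cylinder, \<open>wave n\<close> has frequency
  \<open>\<bar>a\<bar> * \<bar>\<sigma>\<bar> * b ^ n\<close>. This decreases along a branch, so the
  condition is a stopping rule.\<close>

definition settled :: "nat \<Rightarrow> real \<Rightarrow> bool" where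
  "settled n \<sigma> \<longleftrightarrow> \<bar>\<sigma>\<bar> * b ^ n \<le> Q"

text \<open>For an unsettled index nothing is subtracted yet; its coefficient enters only on the
  deeper cylinder where it settles.\<close>

definition deviation :: "nat \<Rightarrow> real \<Rightarrow> real \<Rightarrow> real \<Rightarrow> complex" where
  "deviation N \<sigma> \<tau> x = (\<Sum>n=1..N. wave n (\<sigma> * x + \<tau>) - (if settled n \<sigma> then coef n \<sigma> \<tau> else 0))"

text \<open>A budget: each index still to settle will cost at most
  \<open>\<epsilon>\<close>.\<close>

definition pending :: "nat \<Rightarrow> real \<Rightarrow> real" where
  "pending N \<sigma> = (\<Sum>n=1..N. if settled n \<sigma> then 0 else 1)"

text \<open>One factor 2 comes from the diameter \<open>2 * radius\<close>, the other from
  \<open>sum_geometric_capped\<close>.\<close>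

definition spread :: real where "spread = 4 * \<bar>a\<bar> * radius * Q"

section \<open>Waves and their conditional expectations on a cylinder\<close>

lemma norm_wave [simp]: "norm (wave n x) = 1"
  by (simp add: wave_def)

lemma continuous_wave: "continuous_on A (wave n)"
  unfolding wave_def by (intro continuous_intros)

lemma wave_measurable [measurable]: "wave n \<in> borel_measurable borel"
  by (intro borel_measurable_continuous_onI continuous_wave)

lemma integrable_wave [simp]: "integrable \<nu> (\<lambda>x. wave n (\<sigma> * x + \<tau>))"
  by (rule integrable_bounded_borel[where B=1]) simp_all

lemma deviation_measurable [measurable]: "deviation N \<sigma> \<tau> \<in> borel_measurable borel"
  unfolding deviation_def by measurable

lemma norm_coef_le_1: "norm (coef n \<sigma> \<tau>) \<le> 1"
  unfolding coef_def using prob_space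
  by (intro order.trans[OF integral_norm_bound]) simp

lemma norm_deviation_le: "norm (deviation N \<sigma> \<tau> x) \<le> 2 * real N"
proof -
  have "norm (deviation N \<sigma> \<tau> x) \<le> of_nat (card {1..N}) * 2"
    unfolding deviation_def
  proof (rule sum_norm_bound)
    fix n
    show "norm (wave n (\<sigma> * x + \<tau>) - (if settled n \<sigma> then coef n \<sigma> \<tau> else 0)) \<le> 2"
      using norm_coef_le_1[of n \<sigma> \<tau>]
      by (intro order.trans[OF norm_triangle_ineq4]) auto
  qed
  then show ?thesis by simp
qed

text \<open>\<open>coef\<close> averages \<open>wave n\<close> over a cylinder of length at most
  \<open>2 * radius * \<bar>\<sigma>\<bar>\<close>, and \<open>wave n\<close> has Lipschitz constant
  \<open>\<bar>a\<bar> * b ^ n\<close>.\<close>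

lemma wave_minus_coef_le:
  assumes "\<bar>x\<bar> \<le> radius"
  shows "norm (wave n (\<sigma> * x + \<tau>) - coef n \<sigma> \<tau>) \<le> 2 * \<bar>a\<bar> * radius * (\<bar>\<sigma>\<bar> * b ^ n)"
proof -
  have "wave n (\<sigma> * x + \<tau>) - coef n \<sigma> \<tau> = (CLINT z|\<nu>. wave n (\<sigma> * x + \<tau>) - wave n (\<sigma> * z + \<tau>))"
    using prob_space by (simp add: coef_def)
  also have "norm \<dots> \<le> (\<integral>z. norm (wave n (\<sigma> * x + \<tau>) - wave n (\<sigma> * z + \<tau>)) \<partial>\<nu>)"
    by (rule integral_norm_bound)
  also have "\<dots> \<le> (\<integral>z. 2 * \<bar>a\<bar> * radius * (\<bar>\<sigma>\<bar> * b ^ n) \<partial>\<nu>)"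
  proof (rule integral_mono_AE)
    show "AE z in \<nu>. norm (wave n (\<sigma> * x + \<tau>) - wave n (\<sigma> * z + \<tau>)) \<le> 2 * \<bar>a\<bar> * radius * (\<bar>\<sigma>\<bar> * b ^ n)"
      using AE_within_radius
    proof eventually_elim
      case (elim z)
      have "norm (wave n (\<sigma> * x + \<tau>) - wave n (\<sigma> * z + \<tau>))
          \<le> \<bar>a * b ^ n * (\<sigma> * x + \<tau>) - a * b ^ n * (\<sigma> * z + \<tau>)\<bar>"
        unfolding wave_def by (rule norm_cis_diff_le)
      also have "\<dots> = \<bar>a\<bar> * \<bar>\<sigma>\<bar> * b ^ n * \<bar>x - z\<bar>"
        by (simp add: abs_mult flip: right_diff_distrib mult.assoc)
      also have "\<dots> \<le> \<bar>a\<bar> * \<bar>\<sigma>\<bar> * b ^ n * (2 * radius)"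
        using elim assms by (intro mult_left_mono) auto
      finally show ?case by (simp add: mult_ac)
    qed
  qed simp_all
  finally show ?thesis using prob_space by simp
qed

lemma sum_settled_le:
  assumes "\<And>n. settled n \<sigma> \<Longrightarrow> norm (g n) \<le> 2 * \<bar>a\<bar> * radius * (\<bar>\<sigma>\<bar> * b ^ n)"
  shows "norm (\<Sum>n=1..N. if settled n \<sigma> then g n else (0::complex)) \<le> spread"
proof -
  have "norm (\<Sum>n=1..N. if settled n \<sigma> then g n else 0)
      \<le> (\<Sum>n=1..N. 2 * \<bar>a\<bar> * radius * (if \<bar>\<sigma>\<bar> * b ^ n \<le> Q then \<bar>\<sigma>\<bar> * b ^ n else 0))"
    using assms by (intro sum_norm_le) (auto simp: settled_def)
  also have "\<dots> \<le> 2 * \<bar>a\<bar> * radius * (2 * Q)"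
    unfolding sum_distrib_left[symmetric] using base radius_nonneg threshold
    by (intro mult_left_mono sum_geometric_capped) auto
  finally show ?thesis by (simp add: spread_def)
qed

text \<open>Children arise by precomposition: \<open>x\<close> is first moved by the map
  \<open>i\<close>, then placed in the parent cylinder.\<close>

lemma coef_child: "coef n (\<sigma> * s i) (\<sigma> * t i + \<tau>) = (CLINT x|\<nu>. wave n (\<sigma> * (s i * x + t i) + \<tau>))"
  by (simp add: coef_def algebra_simps)

lemma coef_martingale: "coef n \<sigma> \<tau> = (\<Sum>i<l. p i * coef n (\<sigma> * s i) (\<sigma> * t i + \<tau>))"
  unfolding coef_child unfolding coef_def
  by (rule complex_integral_self_similar[where B=1]) simp_all

text \<open>The child lies inside the parent, so averaging \<open>wave_minus_coef_le\<close> for the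
  parent over the child gives the bound.\<close>

lemma coef_child_minus_coef_le:
  assumes "i < l"
  shows "norm (coef n (\<sigma> * s i) (\<sigma> * t i + \<tau>) - coef n \<sigma> \<tau>) \<le> 2 * \<bar>a\<bar> * radius * (\<bar>\<sigma>\<bar> * b ^ n)"
proof -
  have [simp]: "integrable \<nu> (\<lambda>x. wave n (\<sigma> * (s i * x + t i) + \<tau>))"
    by (rule integrable_bounded_borel[where B=1]) simp_all
  have "coef n (\<sigma> * s i) (\<sigma> * t i + \<tau>) - coef n \<sigma> \<tau>
      = (CLINT x|\<nu>. wave n (\<sigma> * (s i * x + t i) + \<tau>) - coef n \<sigma> \<tau>)"
    using prob_space by (simp add: coef_child)
  also have "norm \<dots> \<le> (\<integral>x. norm (wave n (\<sigma> * (s i * x + t i) + \<tau>) - coef n \<sigma> \<tau>) \<partial>\<nu>)"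
    by (rule integral_norm_bound)
  also have "\<dots> \<le> (\<integral>x. 2 * \<bar>a\<bar> * radius * (\<bar>\<sigma>\<bar> * b ^ n) \<partial>\<nu>)"
  proof (rule integral_mono_AE)
    show "AE x in \<nu>. norm (wave n (\<sigma> * (s i * x + t i) + \<tau>) - coef n \<sigma> \<tau>)
        \<le> 2 * \<bar>a\<bar> * radius * (\<bar>\<sigma>\<bar> * b ^ n)"
      using AE_within_radius
      by eventually_elim (intro wave_minus_coef_le map_within_radius assms)
  qed simp_all
  finally show ?thesis using prob_space by simp
qed

lemma settled_child: "i < l \<Longrightarrow> settled n \<sigma> \<Longrightarrow> settled n (\<sigma> * s i)"
proof -
  assume "i < l" and n: "settled n \<sigma>"
  then have "\<bar>s i\<bar> \<le> 1" using ratio_upper(2) ratio_upper(3)[of i] by linarith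
  then have "\<bar>\<sigma>\<bar> * \<bar>s i\<bar> \<le> \<bar>\<sigma>\<bar> * 1" by (intro mult_left_mono) auto
  then have "\<bar>\<sigma> * s i\<bar> * b ^ n \<le> \<bar>\<sigma>\<bar> * b ^ n"
    by (intro mult_right_mono) (auto simp: abs_mult)
  with n show "settled n (\<sigma> * s i)" unfolding settled_def by linarith
qed

text \<open>Up to a unimodular phase the coefficient is the Fourier transform at \<open>q\<close>;
  the unsettled parent and \<open>\<delta> \<le> \<bar>s i\<bar>\<close> make
  \<open>\<bar>q\<bar>\<close> large.\<close>

lemma norm_coef_newly_settled_le:
  assumes "i < l" "\<not> settled n \<sigma>"
  shows "norm (coef n (\<sigma> * s i) \<tau>) \<le> \<epsilon>"
proof -
  define q where "q = a * b ^ n * (\<sigma> * s i)"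
  have "\<delta> * Q \<le> \<bar>s i\<bar> * (\<bar>\<sigma>\<bar> * b ^ n)"
    using assms ratio_lower threshold by (intro mult_mono) (auto simp: settled_def)
  then have "\<bar>a\<bar> * (\<delta> * Q) \<le> \<bar>a\<bar> * (\<bar>s i\<bar> * (\<bar>\<sigma>\<bar> * b ^ n))"
    by (rule mult_left_mono) simp
  then have "q0 \<le> \<bar>q\<bar>"
    using threshold(2) by (simp add: q_def abs_mult mult_ac)
  have "coef n (\<sigma> * s i) \<tau> = (CLINT x|\<nu>. cis (a * b ^ n * \<tau>) * cis (q * x))"
    unfolding coef_def wave_def by (simp add: cis_mult q_def algebra_simps)
  also have "\<dots> = cis (a * b ^ n * \<tau>) * (CLINT x|\<nu>. cis (q * x))"
    by simp
  finally show ?thesis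
    using decay[OF \<open>q0 \<le> \<bar>q\<bar>\<close>] by (simp add: norm_mult)
qed

text \<open>\<open>w\<close> collects the martingale increments along the branch so far. The
  positive part keeps the quantity nonnegative, so that pointwise bounds pass to squares.\<close>

definition excess :: "nat \<Rightarrow> real \<Rightarrow> real \<Rightarrow> complex \<Rightarrow> real \<Rightarrow> real" where
  "excess N \<sigma> \<tau> w x = max 0 (norm (w + deviation N \<sigma> \<tau> x) - \<epsilon> * pending N \<sigma>)"

lemma excess_measurable [measurable]: "excess N \<sigma> \<tau> w \<in> borel_measurable borel"
  unfolding excess_def by measurable

lemma pending_nonneg: "0 \<le> pending N \<sigma>"
  unfolding pending_def by (intro sum_nonneg) auto

lemma pending_le: "pending N \<sigma> \<le> N"
  using sum_mono[of "{1..N}" "\<lambda>n. if settled n \<sigma> then 0 else 1" "\<lambda>n. 1::real"]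
  by (simp add: pending_def)

lemma excess_square_le: "(excess N \<sigma> \<tau> w x)\<^sup>2 \<le> (norm w + 2 * real N)\<^sup>2"
proof (rule power_mono)
  have "norm (w + deviation N \<sigma> \<tau> x) \<le> norm w + 2 * real N"
    using norm_triangle_ineq[of w "deviation N \<sigma> \<tau> x"] norm_deviation_le[of N \<sigma> \<tau> x] by linarith
  moreover have "0 \<le> \<epsilon> * pending N \<sigma>" using eps pending_nonneg by simp
  ultimately show "excess N \<sigma> \<tau> w x \<le> norm w + 2 * real N"
    unfolding excess_def by simp
qed (simp add: excess_def)

lemma integrable_excess_square: "integrable \<nu> (\<lambda>x. (excess N \<sigma> \<tau> w x)\<^sup>2)"
  by (rule integrable_bounded_borel[where B="(norm w + 2 * real N)\<^sup>2"]) (auto simp: excess_square_le)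

definition increment :: "nat \<Rightarrow> real \<Rightarrow> real \<Rightarrow> nat \<Rightarrow> complex" where
  "increment N \<sigma> \<tau> i =
     (\<Sum>n=1..N. if settled n \<sigma> then coef n (\<sigma> * s i) (\<sigma> * t i + \<tau>) - coef n \<sigma> \<tau> else 0)"

text \<open>Passing to the children of a cylinder moves the martingale increment into \<open>w\<close>; the
  coefficients of the frequencies settled in this step are paid for by the decrease
  of \<^const>\<open>pending\<close>.\<close>

lemma excess_child_le:
  assumes "i < l"
  shows "excess N \<sigma> \<tau> w (s i * x + t i)
    \<le> excess N (\<sigma> * s i) (\<sigma> * t i + \<tau>) (w + increment N \<sigma> \<tau> i) x"
proof -
  define D where "D = increment N \<sigma> \<tau> i"
  define new where "new n \<longleftrightarrow> \<not> settled n \<sigma> \<and> settled n (\<sigma> * s i)" for n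
  define E where "E = (\<Sum>n=1..N. if new n then coef n (\<sigma> * s i) (\<sigma> * t i + \<tau>) else 0)"
  \<comment> \<open>Index by index: settled at the parent (\<open>D\<close>), settled just now
    (\<open>E\<close>), or still pending.\<close>
  have "deviation N \<sigma> \<tau> (s i * x + t i) = D + E + deviation N (\<sigma> * s i) (\<sigma> * t i + \<tau>) x"
    unfolding deviation_def D_def E_def increment_def sum.distrib[symmetric]
    using settled_child[OF assms(1)] by (intro sum.cong) (auto simp: new_def algebra_simps)
  moreover have "norm E \<le> (\<Sum>n=1..N. \<epsilon> * (if new n then 1 else 0))"
    unfolding E_def using norm_coef_newly_settled_le[OF assms(1)]
    by (intro sum_norm_le) (auto simp: new_def)
  moreover have "(\<Sum>n=1..N. \<epsilon> * (if new n then 1 else 0)) = \<epsilon> * (pending N \<sigma> - pending N (\<sigma> * s i))"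
    unfolding pending_def sum_subtractf[symmetric] sum_distrib_left
    using settled_child[OF assms(1)] by (intro sum.cong) (auto simp: new_def)
  moreover have "norm (w + (D + E + deviation N (\<sigma> * s i) (\<sigma> * t i + \<tau>) x))
      \<le> norm (w + D + deviation N (\<sigma> * s i) (\<sigma> * t i + \<tau>) x) + norm E"
    using norm_triangle_ineq[of "w + D + deviation N (\<sigma> * s i) (\<sigma> * t i + \<tau>) x" E]
    by (simp add: add_ac)
  ultimately show ?thesis
    unfolding excess_def D_def[symmetric] by (simp add: right_diff_distrib)
qed

text \<open>\<open>L\<close> counts generations after which all indices up to \<open>N\<close> are
  settled. Each adds at most \<open>spread\<^sup>2\<close> by orthogonality, and the final
  \<open>+ 1\<close> is the fluctuation inside the last cylinders. Generality in
  \<open>\<sigma>\<close>, \<open>\<tau>\<close> and \<open>w\<close> lets the induction descend to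
  the children.\<close>

lemma integral_excess_square_le:
  assumes "\<bar>\<sigma>\<bar> * r ^ L * b ^ N \<le> Q"
  shows "(\<integral>x. (excess N \<sigma> \<tau> w x)\<^sup>2 \<partial>\<nu>) \<le> (norm w)\<^sup>2 + spread\<^sup>2 * (L + 1)"
  using assms
proof (induction L arbitrary: \<sigma> \<tau> w)
  case 0
  \<comment> \<open>At \<open>L = 0\<close> everything is settled: the budget is spent and the
    deviation is centered.\<close>
  have settled: "settled n \<sigma>" if "n \<le> N" for n
  proof -
    have "\<bar>\<sigma>\<bar> * real b ^ n \<le> \<bar>\<sigma>\<bar> * real b ^ N"
      using that base by (intro mult_left_mono power_increasing) auto
    then show ?thesis using 0 by (simp add: settled_def)
  qed
  have dev: "deviation N \<sigma> \<tau> x = (\<Sum>n=1..N. wave n (\<sigma> * x + \<tau>) - coef n \<sigma> \<tau>)" for x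
    unfolding deviation_def using settled by (intro sum.cong) auto
  have "pending N \<sigma> = 0"
    unfolding pending_def using settled by (intro sum.neutral) auto
  then have "(\<integral>x. (excess N \<sigma> \<tau> w x)\<^sup>2 \<partial>\<nu>) = (\<integral>x. (norm (w + deviation N \<sigma> \<tau> x))\<^sup>2 \<partial>\<nu>)"
    by (simp add: excess_def max_def)
  also have "\<dots> \<le> (norm w)\<^sup>2 + spread\<^sup>2"
  proof (rule integral_square_add_centered)
    show "integrable \<nu> (deviation N \<sigma> \<tau>)"
      by (rule integrable_bounded_borel[where B="2 * real N"]) (auto simp: norm_deviation_le)
    show "(CLINT x|\<nu>. deviation N \<sigma> \<tau> x) = 0"
      unfolding dev using prob_space by (simp add: coef_def)
    show "AE x in \<nu>. norm (deviation N \<sigma> \<tau> x) \<le> spread"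
      using AE_within_radius
    proof eventually_elim
      case (elim x)
      have "deviation N \<sigma> \<tau> x = (\<Sum>n=1..N. if settled n \<sigma> then wave n (\<sigma> * x + \<tau>) - coef n \<sigma> \<tau> else 0)"
        unfolding dev using settled by (intro sum.cong) auto
      then show ?case
        using wave_minus_coef_le[OF elim] by (simp only: sum_settled_le)
    qed
  qed
  finally show ?case by simp
next
  case (Suc L)
  define D where "D = increment N \<sigma> \<tau>"
  have "(\<Sum>i<l. p i * D i) = (\<Sum>n=1..N. if settled n \<sigma>
      then (\<Sum>i<l. p i * (coef n (\<sigma> * s i) (\<sigma> * t i + \<tau>) - coef n \<sigma> \<tau>)) else 0)"
    unfolding D_def increment_def sum_distrib_left by (subst sum.swap) (auto intro!: sum.cong)
  also have "\<dots> = 0"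
  proof -
    have "(\<Sum>i<l. complex_of_real (p i)) = 1"
      using sum_weights by (simp flip: of_real_sum)
    then have "(\<Sum>i<l. p i * (coef n (\<sigma> * s i) (\<sigma> * t i + \<tau>) - coef n \<sigma> \<tau>)) = 0" for n
      using coef_martingale[of n \<sigma> \<tau>]
      by (simp add: right_diff_distrib sum_subtractf flip: sum_distrib_right)
    then show ?thesis by (simp only: if_cancel sum.neutral_const)
  qed
  finally have D_centered: "(\<Sum>i<l. p i * D i) = 0" .
  have D_bound: "norm (D i) \<le> spread" if "i < l" for i
    unfolding D_def increment_def by (rule sum_settled_le) (rule coef_child_minus_coef_le[OF that])
  have "(\<integral>x. (excess N \<sigma> \<tau> w x)\<^sup>2 \<partial>\<nu>)
      = (\<Sum>i<l. p i * (\<integral>x. (excess N \<sigma> \<tau> w (s i * x + t i))\<^sup>2 \<partial>\<nu>))"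
    by (rule integral_self_similar[where B="(norm w + 2 * real N)\<^sup>2"]) (auto simp: excess_square_le)
  also have "\<dots> \<le> (\<Sum>i<l. p i * ((norm (w + D i))\<^sup>2 + spread\<^sup>2 * (L + 1)))"
  proof (intro sum_mono mult_left_mono)
    fix i assume "i \<in> {..<l}"
    then have i: "i < l" by simp
    have "(\<integral>x. (excess N \<sigma> \<tau> w (s i * x + t i))\<^sup>2 \<partial>\<nu>)
        \<le> (\<integral>x. (excess N (\<sigma> * s i) (\<sigma> * t i + \<tau>) (w + D i) x)\<^sup>2 \<partial>\<nu>)"
    proof (rule integral_mono)
      show "(excess N \<sigma> \<tau> w (s i * x + t i))\<^sup>2 \<le> (excess N (\<sigma> * s i) (\<sigma> * t i + \<tau>) (w + D i) x)\<^sup>2" for x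
        unfolding D_def by (intro power_mono excess_child_le i) (simp add: excess_def)
      show "integrable \<nu> (\<lambda>x. (excess N \<sigma> \<tau> w (s i * x + t i))\<^sup>2)"
        by (rule integrable_bounded_borel[where B="(norm w + 2 * real N)\<^sup>2"]) (auto simp: excess_square_le)
    qed (rule integrable_excess_square)
    also have "\<dots> \<le> (norm (w + D i))\<^sup>2 + spread\<^sup>2 * (L + 1)"
    proof (rule Suc.IH)
      \<comment> \<open>One generation down, the ratio of the child supplies the factor
        \<open>r\<close> removed from \<open>r ^ Suc L\<close>.\<close>
      have "\<bar>s i\<bar> * (\<bar>\<sigma>\<bar> * r ^ L * b ^ N) \<le> r * (\<bar>\<sigma>\<bar> * r ^ L * b ^ N)"
        using ratio_upper i by (intro mult_right_mono) auto
      then show "\<bar>\<sigma> * s i\<bar> * r ^ L * b ^ N \<le> Q"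
        using Suc.prems by (simp add: abs_mult mult_ac)
    qed
    finally show "(\<integral>x. (excess N \<sigma> \<tau> w (s i * x + t i))\<^sup>2 \<partial>\<nu>)
        \<le> (norm (w + D i))\<^sup>2 + spread\<^sup>2 * (L + 1)" .
  qed (simp add: weight_nonneg)
  also have "\<dots> = (\<Sum>i<l. p i * (norm (w + D i))\<^sup>2) + spread\<^sup>2 * (L + 1)"
    by (simp only: distrib_left sum.distrib sum_weights mult_1 flip: sum_distrib_right)
  also have "(\<Sum>i<l. p i * (norm (w + D i))\<^sup>2) \<le> (norm w)\<^sup>2 + spread\<^sup>2"
    by (rule weighted_square_add_centered[OF weight_nonneg sum_weights D_centered D_bound])
  finally show ?case by (simp add: algebra_simps)
qed

text \<open>At the root cylinder the settled indices satisfy \<open>n < b ^ n \<le> Q\<close>, so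
  their coefficients sum to at most \<open>Q\<close>; the rest is excess plus budget.\<close>

lemma norm_sum_wave_le: "norm (\<Sum>n=1..N. wave n x) \<le> excess N 1 0 0 x + \<epsilon> * N + Q"
proof -
  have split: "(\<Sum>n=1..N. wave n x) = deviation N 1 0 x + (\<Sum>n=1..N. if settled n 1 then coef n 1 0 else 0)"
    unfolding deviation_def sum.distrib[symmetric] by (intro sum.cong) auto
  have "norm (\<Sum>n=1..N. if settled n 1 then coef n 1 0 else 0)
      \<le> (\<Sum>n=1..N. if settled n 1 then 1 else 0)"
    using norm_coef_le_1 by (intro sum_norm_le) auto
  moreover have "(\<Sum>n=1..N. if settled n 1 then 1 else (0::real)) \<le> Q"
  proof -
    have "{n\<in>{1..N}. settled n 1} \<subseteq> {1..nat \<lfloor>Q\<rfloor>}"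
    proof
      fix n assume n: "n \<in> {n\<in>{1..N}. settled n 1}"
      have "n < b ^ n"
        using base by (intro power_gt_expt) auto
      then have "real n < real b ^ n"
        by (metis of_nat_less_iff of_nat_power)
      moreover have "real b ^ n \<le> Q" using n by (simp add: settled_def)
      ultimately have "real n \<le> Q" by linarith
      with n show "n \<in> {1..nat \<lfloor>Q\<rfloor>}" by (simp add: le_nat_floor)
    qed
    from card_mono[OF _ this] have "card {n\<in>{1..N}. settled n 1} \<le> nat \<lfloor>Q\<rfloor>" by simp
    then show ?thesis
      using threshold(1) by (simp add: sum.If_cases Int_def) linarith
  qed
  moreover have "norm (deviation N 1 0 x) \<le> excess N 1 0 0 x + \<epsilon> * pending N 1"
    by (simp add: excess_def)
  moreover have "\<epsilon> * pending N 1 \<le> \<epsilon> * N"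
    using pending_le eps by (intro mult_left_mono)
  ultimately show ?thesis
    unfolding split using norm_triangle_ineq[of "deviation N 1 0 x" "\<Sum>n=1..N. if settled n 1 then coef n 1 0 else 0"]
    by linarith
qed

text \<open>The normalized excess \<open>V j\<close> has second moment
  \<open>O(1 / j\<^sup>2)\<close>, so its squares are almost surely summable and \<open>V j\<close>
  tends to 0. What remains is \<open>\<epsilon>\<close> and the vanishing term
  \<open>Q / j\<^sup>2\<close>.\<close>

lemma AE_square_means_small:
  assumes "\<epsilon> < \<eta>"
  shows "AE x in \<nu>. \<forall>\<^sub>F j in sequentially. norm (\<Sum>n=1..j\<^sup>2. wave n x) / real (j\<^sup>2) < \<eta>"
proof -
  \<comment> \<open>\<open>h\<close> generations contract by more than a factor \<open>b\<close>, so
    \<open>h * N\<close> generations settle every index up to \<open>N\<close>.\<close>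
  obtain h where h: "r ^ h < 1 / b"
    using real_arch_pow_inv[of "1 / b" r] ratio_upper base by auto
  define V where "V j x = excess (j\<^sup>2) 1 0 0 x / real (j\<^sup>2)" for j x
  define C where "C = spread\<^sup>2 * (h + 1)"
  have int_V: "(\<integral>x. (V j x)\<^sup>2 \<partial>\<nu>) \<le> C * inverse (real j ^ 2)" if "0 < j" for j
  proof -
    define N where "N = j\<^sup>2"
    have "r ^ (h * N) * b ^ N = (r ^ h * b) ^ N"
      by (simp add: power_mult power_mult_distrib)
    also have "\<dots> \<le> 1"
      using h base ratio_upper by (intro power_le_one) (auto simp: field_simps)
    finally have "r ^ (h * N) * b ^ N \<le> Q" using threshold(1) by linarith
    then have "(\<integral>x. (excess N 1 0 0 x)\<^sup>2 \<partial>\<nu>) \<le> spread\<^sup>2 * (real (h * N) + 1)"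
      using integral_excess_square_le[of 1 "h * N" N 0 0] by (simp add: add.commute)
    also have "\<dots> \<le> C * N"
    proof -
      have "1 \<le> N" using that by (simp add: N_def)
      then have "real (h * N) + 1 \<le> (real h + 1) * N"
        by (simp add: algebra_simps)
      from mult_left_mono[OF this, of "spread\<^sup>2"] show ?thesis
        unfolding C_def by (simp add: mult_ac add.commute)
    qed
    finally have "(\<integral>x. (excess N 1 0 0 x)\<^sup>2 \<partial>\<nu>) / (real N)\<^sup>2 \<le> C * N / (real N)\<^sup>2"
      by (rule divide_right_mono) simp
    also have "\<dots> = C * inverse (real j ^ 2)"
      using that by (simp add: N_def power2_eq_square field_simps)
    finally show ?thesis
      by (simp add: V_def N_def power_divide)
  qed
  have "(\<integral>\<^sup>+x. (\<Sum>j. ennreal ((V (Suc j) x)\<^sup>2)) \<partial>\<nu>) = (\<Sum>j. \<integral>\<^sup>+x. ennreal ((V (Suc j) x)\<^sup>2) \<partial>\<nu>)"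
    unfolding V_def by (rule nn_integral_suminf) measurable
  also have "\<dots> \<le> (\<Sum>j. ennreal (C * inverse (real (Suc j) ^ 2)))"
  proof (rule suminf_le)
    fix j
    have "integrable \<nu> (\<lambda>x. (V (Suc j) x)\<^sup>2)"
      unfolding V_def power_divide by (intro integrable_divide_zero) (simp add: integrable_excess_square)
    then show "(\<integral>\<^sup>+x. ennreal ((V (Suc j) x)\<^sup>2) \<partial>\<nu>) \<le> ennreal (C * inverse (real (Suc j) ^ 2))"
      using int_V[of "Suc j"] by (subst nn_integral_eq_integral) (auto intro: ennreal_leI)
  qed auto
  also have "\<dots> < top"
  proof -
    have "summable (\<lambda>j. inverse (real (Suc j) ^ 2))"
      using inverse_power_summable[of 2, where 'a=real] by (subst summable_Suc_iff) simp
    then have "summable (\<lambda>j. C * inverse (real (Suc j) ^ 2))"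
      by (rule summable_mult)
    then show ?thesis
      using suminf_ennreal_eq summable_sums by (subst suminf_ennreal2) (auto simp: C_def)
  qed
  finally have "AE x in \<nu>. (\<Sum>j. ennreal ((V (Suc j) x)\<^sup>2)) \<noteq> \<infinity>"
    unfolding V_def by (intro nn_integral_PInf_AE) auto
  then show ?thesis
  proof eventually_elim
    case (elim x)
    then have "summable (\<lambda>j. (V (Suc j) x)\<^sup>2)"
      by (intro summable_suminf_not_top) auto
    then have "(\<lambda>j. (V (Suc j) x)\<^sup>2) \<longlonglongrightarrow> 0"
      by (rule summable_LIMSEQ_zero)
    then have "(\<lambda>j. sqrt ((V (Suc j) x)\<^sup>2)) \<longlonglongrightarrow> sqrt 0"
      by (intro tendsto_real_sqrt)
    moreover have "0 \<le> V j x" for j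
      by (simp add: V_def excess_def)
    ultimately have "(\<lambda>j. V j x) \<longlonglongrightarrow> 0"
      using LIMSEQ_imp_Suc by simp
    moreover have "(\<lambda>j. Q / real (j\<^sup>2)) \<longlonglongrightarrow> 0"
      by real_asymp
    ultimately have "(\<lambda>j. V j x + \<epsilon> + Q / real (j\<^sup>2)) \<longlonglongrightarrow> 0 + \<epsilon> + 0"
      by (intro tendsto_intros)
    then have "\<forall>\<^sub>F j in sequentially. V j x + \<epsilon> + Q / real (j\<^sup>2) < \<eta>"
      using assms by (intro order_tendstoD) auto
    then show ?case
      using eventually_gt_at_top[of 0]
    proof eventually_elim
      case (elim j)
      have "norm (\<Sum>n=1..j\<^sup>2. wave n x) / real (j\<^sup>2)
          \<le> (excess (j\<^sup>2) 1 0 0 x + \<epsilon> * real (j\<^sup>2) + Q) / real (j\<^sup>2)"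
        by (intro divide_right_mono norm_sum_wave_le) simp
      also have "\<dots> = V j x + \<epsilon> + Q / real (j\<^sup>2)"
        using elim by (simp add: V_def add_divide_distrib)
      finally show ?case using elim by simp
    qed
  qed
qed

end

text \<open>Each tolerance \<open>1 / Suc m\<close> has its own \<open>\<epsilon>\<close>,
  \<open>q0\<close> and \<open>Q\<close>, hence its own null set; countably many of these are
  combined before passing from squares to all \<open>N\<close>.\<close>

lemma (in self_similar_distribution) AE_exponential_means_vanish:
  fixes a :: real and b :: nat
  assumes "a \<noteq> 0" "2 \<le> b" and lim: "((\<lambda>q. CLINT x|\<nu>. cis (q * x)) \<longlongrightarrow> 0) at_infinity"
  shows "AE x in \<nu>. (\<lambda>N. (\<Sum>n=1..N. cis (a * b ^ n * x)) / of_nat N) \<longlonglongrightarrow> 0"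
proof -
  define S where "S j x = norm (\<Sum>n=1..j\<^sup>2. cis (a * b ^ n * x)) / real (j\<^sup>2)" for j x
  have small: "AE x in \<nu>. \<forall>\<^sub>F j in sequentially. S j x < 1 / Suc m" for m
  proof -
    define \<epsilon> where "\<epsilon> = 1 / (2 * real (Suc m))"
    have "0 < \<epsilon>" "\<epsilon> < 1 / Suc m" by (simp_all add: \<epsilon>_def field_simps)
    obtain q0 where q0: "\<And>q. q0 \<le> \<bar>q\<bar> \<Longrightarrow> norm (CLINT x|\<nu>. cis (q * x)) < \<epsilon>"
      using tendstoD[OF lim \<open>0 < \<epsilon>\<close>] by (auto simp: eventually_at_infinity)
    define Q where "Q = max 1 (q0 / (\<bar>a\<bar> * \<delta>))"
    have "q0 / (\<bar>a\<bar> * \<delta>) \<le> Q" by (simp add: Q_def)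
    then have "q0 \<le> \<bar>a\<bar> * \<delta> * Q"
      using \<open>a \<noteq> 0\<close> ratio_lower(1) by (simp add: field_simps)
    then interpret rajchman_self_similar \<nu> l s t p \<delta> r T a \<epsilon> q0 Q b
      using \<open>2 \<le> b\<close> \<open>0 < \<epsilon>\<close> q0 by unfold_locales (auto simp: Q_def intro: less_imp_le)
    show ?thesis
      using AE_square_means_small[OF \<open>\<epsilon> < 1 / Suc m\<close>] by (simp only: wave_def S_def)
  qed
  have "AE x in \<nu>. \<forall>m. \<forall>\<^sub>F j in sequentially. S j x < 1 / Suc m"
    unfolding AE_all_countable using small by blast
  then show ?thesis
  proof eventually_elim
    case (elim x)
    have "(\<lambda>j. S j x) \<longlonglongrightarrow> 0"
    proof (rule tendstoI)
      fix e :: real assume "0 < e"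
      then obtain m where m: "1 / Suc m < e" using nat_approx_posE by blast
      from spec[OF elim, of m] show "\<forall>\<^sub>F j in sequentially. dist (S j x) 0 < e"
        by eventually_elim (use m in \<open>simp add: S_def\<close>)
    qed
    then show ?case
      unfolding S_def by (intro means_tendsto_zero_if_square_means) simp_all
  qed
qed

section \<open>Pointwise absolute normality\<close>

lemma self_similar_measure_imp_distribution:
  assumes "self_similar_measure \<nu>"
  obtains l s t p \<delta> r T where "self_similar_distribution \<nu> l s t p \<delta> r T"
proof -
  from assms obtain l s t p where \<nu>: "real_distribution \<nu>" and ifs: "self_similar_ifs l s t"
    and p: "positive_prob_vector l p"
    and inv: "\<nu> = lin_comb {..<l} p (\<lambda>i. distr \<nu> borel (ifs_map s t i))"
    unfolding self_similar_measure_def by blast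
  define \<delta> r T where "\<delta> = Min ((\<lambda>i. \<bar>s i\<bar>) ` {..<l})" and "r = Max ((\<lambda>i. \<bar>s i\<bar>) ` {..<l})"
    and "T = Max ((\<lambda>i. \<bar>t i\<bar>) ` {..<l})"
  have s: "0 < \<bar>s i\<bar>" "\<bar>s i\<bar> < 1" if "i < l" for i
    using ifs that by (auto simp: self_similar_ifs_def)
  \<comment> \<open>The fixed points required of the IFS force at least one map, so the minimum and
    the maxima are over nonempty sets.\<close>
  have "0 < l" using ifs by (auto simp: self_similar_ifs_def)
  then have ne: "{..<l} \<noteq> {}" by auto
  have "\<delta> \<le> \<bar>s i\<bar>" "\<bar>s i\<bar> \<le> r" "\<bar>t i\<bar> \<le> T" if "i < l" for i
    using that by (simp_all add: \<delta>_def r_def T_def)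
  moreover have "0 < \<delta>" "r < 1"
    using ne s by (simp_all add: \<delta>_def r_def)
  moreover have "0 < r" "0 \<le> T"
    using calculation(2,3)[OF \<open>0 < l\<close>] s(1)[OF \<open>0 < l\<close>] by linarith+
  ultimately have "self_similar_distribution \<nu> l s t p \<delta> r T"
    using \<nu> inv p
    by (intro self_similar_distribution.intro self_similar_distribution_axioms.intro)
      (auto simp: positive_prob_vector_def intro: less_imp_le)
  then show ?thesis by (rule that)
qed

theorem theorem1p2:
  fixes \<nu> :: "real measure"
  assumes "self_similar_measure \<nu>"
    and "non_atomic \<nu>"
    and "(fourier_transform \<nu> \<longlongrightarrow> 0) at_infinity"
  shows "pointwise_absolutely_normal \<nu>"
proof -
  from assms(1) obtain l s t p \<delta> r T where "self_similar_distribution \<nu> l s t p \<delta> r T"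
    by (rule self_similar_measure_imp_distribution)
  then interpret self_similar_distribution \<nu> l s t p \<delta> r T .
  \<comment> \<open>Rescaling by \<open>2 * pi\<close> passes from the normalization of
    \<open>fourier_transform\<close> to that of \<open>cis (q * x)\<close>.\<close>
  have "filterlim (\<lambda>q. q / (2 * pi)) at_infinity at_infinity"
    using tendsto_mult_filterlim_at_infinity[of "\<lambda>_. 1 / (2 * pi)" "1 / (2 * pi)" at_infinity "\<lambda>q. q"]
    by (simp add: filterlim_ident)
  then have "((\<lambda>q. fourier_transform \<nu> (q / (2 * pi))) \<longlongrightarrow> 0) at_infinity"
    by (rule filterlim_compose[OF assms(3)])
  also have "(\<lambda>q. fourier_transform \<nu> (q / (2 * pi))) = (\<lambda>q. CLINT x|\<nu>. cis (q * x))"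
    by (simp add: fourier_transform_def cis_conv_exp mult_ac)
  finally have "AE x in \<nu>. (\<lambda>N. (\<Sum>n=1..N. cis (2 * pi * real_of_int k * b ^ n * x)) / of_nat N) \<longlonglongrightarrow> 0"
    if "k \<noteq> 0" "2 \<le> b" for k :: int and b :: nat
    using AE_exponential_means_vanish[of "2 * pi * of_int k" b] that by simp
  \<comment> \<open>There are countably many pairs \<open>(k, b)\<close>, so one null set serves all
    frequencies and all bases.\<close>
  then have "AE x in \<nu>. \<forall>(k::int) (b::nat). k \<noteq> 0 \<longrightarrow> 2 \<le> b \<longrightarrow>
      (\<lambda>N. (\<Sum>n=1..N. cis (2 * pi * real_of_int k * b ^ n * x)) / of_nat N) \<longlonglongrightarrow> 0"
    unfolding AE_all_countable by (auto simp: AE_all_countable)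
  then show ?thesis
    unfolding pointwise_absolutely_normal_def
  proof eventually_elim
    case (elim x)
    then show ?case
      unfolding absolutely_normal_def
      by (auto intro!: normal_to_base_if_weyl_sums_vanish simp flip: mult.assoc)
  qed
qed

end
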